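(* Let $R$ be a ring. The following are equivalent. (1) $R$ is a dual ring. (2) $R$ is a semilocal and small dual ring. (3) $R$ is a semiperfect and small dual ring. (4) $R$ is a two-sided Kasch and two-sided simple injective ring.
   Context: Rings are associative with identity (not necessarily commutative). For a subset $X\subseteq R$, $\mathbf{l}(X)=\{r\in R: rx=0 \text{ for all } x\in X\}$ and $\mathbf{r}(X)=\{r\in R: xr=0\text{ for all }x\in X\}$. A right ideal $I$ is a right annihilator if $I=\mathbf{r}(X)$ for some $X\subseteq R$, equivalently $\mathbf{r}(\mathbf{l}(I))=I$; left annihilators are defined symmetrically. A right ideal $I$ is small if $I+K\neq R$ for every proper right ideal $K$ of $R$; small left ideals are defined symmetrically. $R$ is right dual (resp. right small dual) if every right ideal (resp. every small right ideal) of $R$ is a right annihilator; left versions are symmetric; $R$ is dual (resp. small dual) if it is both left and right dual (resp. left and right small dual). $R$ is semilocal if $R/J$ is semisimple artinian, where $J$ is the Jacobson radical; $R$ is semiperfect if it is semilocal and idempotents lift modulo $J$. $R$ is right Kasch if every maximal right ideal is a right annihilator; left Kasch is symmetric; two-sided Kasch means both. $R$ is right simple injective if every right $R$-homomorphism with simple image from a right ideal $I$ of $R$ to $R_R$ extends to a homomorphism $R_R\to R_R$; left simple injective is symmetric; two-sided simple injective means both. *)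

theory Defs
  imports "HOL-Algebra.QuotRing"
begin

definition right_ideal :: "'a set \<Rightarrow> ('a, 'b) ring_scheme \<Rightarrow> bool" where
  "right_ideal I R \<longleftrightarrow>
     additive_subgroup I R \<and> (\<forall>x\<in>I. \<forall>r\<in>carrier R. x \<otimes>\<^bsub>R\<^esub> r \<in> I)"

definition left_ideal :: "'a set \<Rightarrow> ('a, 'b) ring_scheme \<Rightarrow> bool" where
  "left_ideal I R \<longleftrightarrow>
     additive_subgroup I R \<and> (\<forall>x\<in>I. \<forall>r\<in>carrier R. r \<otimes>\<^bsub>R\<^esub> x \<in> I)"

definition r_ann :: "('a, 'b) ring_scheme \<Rightarrow> 'a set \<Rightarrow> 'a set" where
  "r_ann R X = {r \<in> carrier R. \<forall>x\<in>X. x \<otimes>\<^bsub>R\<^esub> r = \<zero>\<^bsub>R\<^esub>}"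

definition l_ann :: "('a, 'b) ring_scheme \<Rightarrow> 'a set \<Rightarrow> 'a set" where
  "l_ann R X = {r \<in> carrier R. \<forall>x\<in>X. r \<otimes>\<^bsub>R\<^esub> x = \<zero>\<^bsub>R\<^esub>}"

definition right_annihilator :: "'a set \<Rightarrow> ('a, 'b) ring_scheme \<Rightarrow> bool" where
  "right_annihilator I R \<longleftrightarrow> (\<exists>X \<subseteq> carrier R. I = r_ann R X)"

definition left_annihilator :: "'a set \<Rightarrow> ('a, 'b) ring_scheme \<Rightarrow> bool" where
  "left_annihilator I R \<longleftrightarrow> (\<exists>X \<subseteq> carrier R. I = l_ann R X)"

definition small_right_ideal :: "'a set \<Rightarrow> ('a, 'b) ring_scheme \<Rightarrow> bool" where
  "small_right_ideal I R \<longleftrightarrow> right_ideal I R \<and>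
     (\<forall>K. right_ideal K R \<and> K \<noteq> carrier R \<longrightarrow> I <+>\<^bsub>R\<^esub> K \<noteq> carrier R)"

definition small_left_ideal :: "'a set \<Rightarrow> ('a, 'b) ring_scheme \<Rightarrow> bool" where
  "small_left_ideal I R \<longleftrightarrow> left_ideal I R \<and>
     (\<forall>K. left_ideal K R \<and> K \<noteq> carrier R \<longrightarrow> I <+>\<^bsub>R\<^esub> K \<noteq> carrier R)"

definition maximal_right_ideal :: "'a set \<Rightarrow> ('a, 'b) ring_scheme \<Rightarrow> bool" where
  "maximal_right_ideal M R \<longleftrightarrow> right_ideal M R \<and> M \<noteq> carrier R \<and>
     (\<forall>K. right_ideal K R \<and> M \<subseteq> K \<longrightarrow> K = M \<or> K = carrier R)"

definition maximal_left_ideal :: "'a set \<Rightarrow> ('a, 'b) ring_scheme \<Rightarrow> bool" where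
  "maximal_left_ideal M R \<longleftrightarrow> left_ideal M R \<and> M \<noteq> carrier R \<and>
     (\<forall>K. left_ideal K R \<and> M \<subseteq> K \<longrightarrow> K = M \<or> K = carrier R)"

definition simple_right_ideal :: "'a set \<Rightarrow> ('a, 'b) ring_scheme \<Rightarrow> bool" where
  "simple_right_ideal S R \<longleftrightarrow> right_ideal S R \<and> S \<noteq> {\<zero>\<^bsub>R\<^esub>} \<and>
     (\<forall>K. right_ideal K R \<and> K \<subseteq> S \<longrightarrow> K = {\<zero>\<^bsub>R\<^esub>} \<or> K = S)"

definition simple_left_ideal :: "'a set \<Rightarrow> ('a, 'b) ring_scheme \<Rightarrow> bool" where
  "simple_left_ideal S R \<longleftrightarrow> left_ideal S R \<and> S \<noteq> {\<zero>\<^bsub>R\<^esub>} \<and>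
     (\<forall>K. left_ideal K R \<and> K \<subseteq> S \<longrightarrow> K = {\<zero>\<^bsub>R\<^esub>} \<or> K = S)"

definition right_dual :: "('a, 'b) ring_scheme \<Rightarrow> bool" where
  "right_dual R \<longleftrightarrow> (\<forall>I. right_ideal I R \<longrightarrow> right_annihilator I R)"

definition left_dual :: "('a, 'b) ring_scheme \<Rightarrow> bool" where
  "left_dual R \<longleftrightarrow> (\<forall>I. left_ideal I R \<longrightarrow> left_annihilator I R)"

definition dual_ring :: "('a, 'b) ring_scheme \<Rightarrow> bool" where
  "dual_ring R \<longleftrightarrow> left_dual R \<and> right_dual R"

definition right_small_dual :: "('a, 'b) ring_scheme \<Rightarrow> bool" where
  "right_small_dual R \<longleftrightarrow> (\<forall>I. small_right_ideal I R \<longrightarrow> right_annihilator I R)"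

definition left_small_dual :: "('a, 'b) ring_scheme \<Rightarrow> bool" where
  "left_small_dual R \<longleftrightarrow> (\<forall>I. small_left_ideal I R \<longrightarrow> left_annihilator I R)"

definition small_dual_ring :: "('a, 'b) ring_scheme \<Rightarrow> bool" where
  "small_dual_ring R \<longleftrightarrow> left_small_dual R \<and> right_small_dual R"

text \<open>As usual, the intersection of no maximal right ideals (which happens only in the
  zero ring) is the whole ring.\<close>

definition jacobson_radical :: "('a, 'b) ring_scheme \<Rightarrow> 'a set" where
  "jacobson_radical R = {x \<in> carrier R. \<forall>M. maximal_right_ideal M R \<longrightarrow> x \<in> M}"

definition right_artinian :: "('a, 'b) ring_scheme \<Rightarrow> bool" where
  "right_artinian R \<longleftrightarrow>
     (\<forall>I :: nat \<Rightarrow> 'a set. (\<forall>n. right_ideal (I n) R \<and> I (Suc n) \<subseteq> I n) \<longrightarrow>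
        (\<exists>N. \<forall>n\<ge>N. I n = I N))"

definition left_artinian :: "('a, 'b) ring_scheme \<Rightarrow> bool" where
  "left_artinian R \<longleftrightarrow>
     (\<forall>I :: nat \<Rightarrow> 'a set. (\<forall>n. left_ideal (I n) R \<and> I (Suc n) \<subseteq> I n) \<longrightarrow>
        (\<exists>N. \<forall>n\<ge>N. I n = I N))"

text \<open>A ring is semisimple if it is semisimple as a right module over itself, that is, if
  every right ideal is a direct summand. By the Wedderburn--Artin theorem this is
  left-right symmetric (and implies both chain conditions).\<close>

definition semisimple_ring :: "('a, 'b) ring_scheme \<Rightarrow> bool" where
  "semisimple_ring R \<longleftrightarrow>
     (\<forall>I. right_ideal I R \<longrightarrow>
        (\<exists>K. right_ideal K R \<and> I <+>\<^bsub>R\<^esub> K = carrier R \<and> I \<inter> K = {\<zero>\<^bsub>R\<^esub>}))"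

definition semisimple_artinian :: "('a, 'b) ring_scheme \<Rightarrow> bool" where
  "semisimple_artinian R \<longleftrightarrow> semisimple_ring R \<and> right_artinian R \<and> left_artinian R"

definition semilocal :: "('a, 'b) ring_scheme \<Rightarrow> bool" where
  "semilocal R \<longleftrightarrow> semisimple_artinian (R Quot jacobson_radical R)"

definition idempotents_lift_mod :: "'a set \<Rightarrow> ('a, 'b) ring_scheme \<Rightarrow> bool" where
  "idempotents_lift_mod J R \<longleftrightarrow>
     (\<forall>x\<in>carrier R. x \<otimes>\<^bsub>R\<^esub> x \<ominus>\<^bsub>R\<^esub> x \<in> J \<longrightarrow>
        (\<exists>e\<in>carrier R. e \<otimes>\<^bsub>R\<^esub> e = e \<and> e \<ominus>\<^bsub>R\<^esub> x \<in> J))"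

definition semiperfect :: "('a, 'b) ring_scheme \<Rightarrow> bool" where
  "semiperfect R \<longleftrightarrow> semilocal R \<and> idempotents_lift_mod (jacobson_radical R) R"

definition right_kasch :: "('a, 'b) ring_scheme \<Rightarrow> bool" where
  "right_kasch R \<longleftrightarrow> (\<forall>M. maximal_right_ideal M R \<longrightarrow> right_annihilator M R)"

definition left_kasch :: "('a, 'b) ring_scheme \<Rightarrow> bool" where
  "left_kasch R \<longleftrightarrow> (\<forall>M. maximal_left_ideal M R \<longrightarrow> left_annihilator M R)"

text \<open>Homomorphisms of right (left) modules from a right (left) ideal \<open>I\<close> to the ring;
  values outside \<open>I\<close> are irrelevant.\<close>

definition right_module_hom :: "('a, 'b) ring_scheme \<Rightarrow> 'a set \<Rightarrow> ('a \<Rightarrow> 'a) \<Rightarrow> bool" where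
  "right_module_hom R I f \<longleftrightarrow> f \<in> I \<rightarrow> carrier R \<and>
     (\<forall>x\<in>I. \<forall>y\<in>I. f (x \<oplus>\<^bsub>R\<^esub> y) = f x \<oplus>\<^bsub>R\<^esub> f y) \<and>
     (\<forall>x\<in>I. \<forall>r\<in>carrier R. f (x \<otimes>\<^bsub>R\<^esub> r) = f x \<otimes>\<^bsub>R\<^esub> r)"

definition left_module_hom :: "('a, 'b) ring_scheme \<Rightarrow> 'a set \<Rightarrow> ('a \<Rightarrow> 'a) \<Rightarrow> bool" where
  "left_module_hom R I f \<longleftrightarrow> f \<in> I \<rightarrow> carrier R \<and>
     (\<forall>x\<in>I. \<forall>y\<in>I. f (x \<oplus>\<^bsub>R\<^esub> y) = f x \<oplus>\<^bsub>R\<^esub> f y) \<and>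
     (\<forall>x\<in>I. \<forall>r\<in>carrier R. f (r \<otimes>\<^bsub>R\<^esub> x) = r \<otimes>\<^bsub>R\<^esub> f x)"

definition right_simple_injective :: "('a, 'b) ring_scheme \<Rightarrow> bool" where
  "right_simple_injective R \<longleftrightarrow>
     (\<forall>I f. right_ideal I R \<and> right_module_hom R I f \<and> simple_right_ideal (f ` I) R \<longrightarrow>
        (\<exists>g. right_module_hom R (carrier R) g \<and> (\<forall>x\<in>I. g x = f x)))"

definition left_simple_injective :: "('a, 'b) ring_scheme \<Rightarrow> bool" where
  "left_simple_injective R \<longleftrightarrow>
     (\<forall>I f. left_ideal I R \<and> left_module_hom R I f \<and> simple_left_ideal (f ` I) R \<longrightarrow>
        (\<exists>g. left_module_hom R (carrier R) g \<and> (\<forall>x\<in>I. g x = f x)))"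

definition two_sided_kasch :: "('a, 'b) ring_scheme \<Rightarrow> bool" where
  "two_sided_kasch R \<longleftrightarrow> left_kasch R \<and> right_kasch R"

definition two_sided_simple_injective :: "('a, 'b) ring_scheme \<Rightarrow> bool" where
  "two_sided_simple_injective R \<longleftrightarrow> left_simple_injective R \<and> right_simple_injective R"

end

theory Submission
  imports Defs
begin

text \<open>Left-sided statements are right-sided statements about the opposite ring. Kasch and simple
  injective rings are dual, as a simple quotient of a cyclic module \<open>(bR + I)/I\<close> embeds into the
  ring, and the embedding is a left multiplication. If \<open>R/J\<close> is artinian, every right ideal \<open>I\<close>
  has a \<open>K\<close> with \<open>I + K = R\<close> and \<open>I \<inter> K \<subseteq> J\<close>; a homomorphism on \<open>I\<close> extends if its restriction
  to \<open>I \<inter> K\<close> does, and there the annihilator conditions on small ideals suffice. In a dual ring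
  taking annihilators is an anti-isomorphism between the lattices of right and left ideals, so
  Zorn's lemma yields minimal complements, and the ring is semiperfect.\<close>

text \<open>Small duality speaks only of ideals inside the radical \<open>J\<close>, whereas Kasch
  and simple injectivity concern all right ideals. The bridge is the complement \<open>K\<close>: if
  \<open>1 = i + k\<close>, then \<open>k\<close> multiplies \<open>I\<close> into
  \<open>I \<inter> K\<close>, hence into \<open>J\<close>, where annihilators are under control.
  Each side of simple injectivity uses both halves of small duality: a kernel must be a right
  annihilator and a principal left ideal a left annihilator. Minimal complements cannot be had from
  Zorn's lemma directly, because the intersection of a chain of complements need not be a
  complement. For semilocal rings they come from the chain condition in \<open>R/J\<close>; for dual
  rings the passage to annihilators reverses the order, so that a maximal left ideal is sought
  instead. A dual ring comes with no chain condition, yet semilocality asks for one on each side of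
  \<open>R/J\<close>. It is recovered from semisimplicity of \<open>R/J\<close> and of its
  opposite.\<close>

no_notation Sum_Type.Plus (infixr \<open><+>\<close> 65)

section \<open>One-sided ideals\<close>

context ring
begin

text \<open>Closure under negatives comes for free from
  \<open>\<ominus> x = x \<otimes> (\<ominus> \<one>)\<close>.\<close>

lemma right_idealI:
  assumes "I \<subseteq> carrier R" "\<zero> \<in> I"
    and "\<And>x y. x \<in> I \<Longrightarrow> y \<in> I \<Longrightarrow> x \<oplus> y \<in> I"
    and m: "\<And>x r. x \<in> I \<Longrightarrow> r \<in> carrier R \<Longrightarrow> x \<otimes> r \<in> I"
  shows "right_ideal I R"
proof -
  have "\<ominus> x \<in> I" if "x \<in> I" for x
  proof -
    have "\<ominus> x = x \<otimes> (\<ominus> \<one>)" using that assms(1) by (auto simp: r_minus)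
    then show ?thesis using m[OF that, of "\<ominus> \<one>"] by simp
  qed
  then have "subgroup I (add_monoid R)"
    using assms by (intro subgroup.intro) (auto simp: a_inv_def[symmetric])
  then show ?thesis using m by (simp add: right_ideal_def additive_subgroup_def)
qed

lemma
  assumes "right_ideal I R"
  shows right_ideal_subset: "I \<subseteq> carrier R"
    and right_ideal_zero: "\<zero> \<in> I"
    and right_ideal_add: "x \<in> I \<Longrightarrow> y \<in> I \<Longrightarrow> x \<oplus> y \<in> I"
    and right_ideal_mult: "x \<in> I \<Longrightarrow> r \<in> carrier R \<Longrightarrow> x \<otimes> r \<in> I"
    and right_ideal_minus: "x \<in> I \<Longrightarrow> y \<in> I \<Longrightarrow> x \<ominus> y \<in> I"
proof -
  have a: "additive_subgroup I R" using assms by (simp add: right_ideal_def)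
  interpret additive_subgroup I R by (rule a)
  show "I \<subseteq> carrier R" "\<zero> \<in> I" "x \<in> I \<Longrightarrow> y \<in> I \<Longrightarrow> x \<oplus> y \<in> I"
    "x \<in> I \<Longrightarrow> y \<in> I \<Longrightarrow> x \<ominus> y \<in> I"
    by (auto simp: a_subset a_minus_def)
  show "x \<in> I \<Longrightarrow> r \<in> carrier R \<Longrightarrow> x \<otimes> r \<in> I"
    using assms by (simp add: right_ideal_def)
qed

lemma right_ideal_in_carrier: "right_ideal I R \<Longrightarrow> x \<in> I \<Longrightarrow> x \<in> carrier R"
  using right_ideal_subset by blast

lemma right_ideal_eq_carrier: "right_ideal I R \<Longrightarrow> \<one> \<in> I \<Longrightarrow> I = carrier R"
  using right_ideal_subset right_ideal_mult[of I \<one>] by fastforce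

lemma right_ideal_carrier: "right_ideal (carrier R) R"
  by (rule right_idealI) auto

lemma right_ideal_Int: "right_ideal I R \<Longrightarrow> right_ideal K R \<Longrightarrow> right_ideal (I \<inter> K) R"
  by (rule right_idealI)
    (auto intro: right_ideal_add right_ideal_mult right_ideal_zero dest: right_ideal_in_carrier)

lemma mem_set_add_iff: "x \<in> A <+> B \<longleftrightarrow> (\<exists>a\<in>A. \<exists>b\<in>B. x = a \<oplus> b)"
  by (auto simp: set_add_def')

lemma right_ideal_set_add:
  assumes I: "right_ideal I R" and K: "right_ideal K R"
  shows "right_ideal (I <+> K) R"
proof (rule right_idealI)
  note c = right_ideal_in_carrier[OF I] right_ideal_in_carrier[OF K]
  show "I <+> K \<subseteq> carrier R" by (auto simp: mem_set_add_iff c)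
  show "\<zero> \<in> I <+> K"
    unfolding mem_set_add_iff
    by (rule bexI[OF _ right_ideal_zero[OF I]], rule bexI[OF _ right_ideal_zero[OF K]]) simp
next
  fix x y assume "x \<in> I <+> K" "y \<in> I <+> K"
  then obtain a b a' b' where ab: "a \<in> I" "b \<in> K" "a' \<in> I" "b' \<in> K" "x = a \<oplus> b" "y = a' \<oplus> b'"
    by (auto simp: mem_set_add_iff)
  have "a \<in> carrier R" "b \<in> carrier R" "a' \<in> carrier R" "b' \<in> carrier R"
    using ab right_ideal_in_carrier I K by auto
  then have "x \<oplus> y = (a \<oplus> a') \<oplus> (b \<oplus> b')" using ab by (simp add: a_ac)
  then show "x \<oplus> y \<in> I <+> K"
    using ab I K unfolding mem_set_add_iff by (blast intro: right_ideal_add)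
next
  fix x r assume "x \<in> I <+> K" and r: "r \<in> carrier R"
  then obtain a b where ab: "a \<in> I" "b \<in> K" "x = a \<oplus> b"
    by (auto simp: mem_set_add_iff)
  have "a \<in> carrier R" "b \<in> carrier R"
    using ab right_ideal_in_carrier I K by auto
  then have "x \<otimes> r = a \<otimes> r \<oplus> b \<otimes> r" using ab r by (simp add: l_distr)
  then show "x \<otimes> r \<in> I <+> K"
    using ab I K r unfolding mem_set_add_iff by (blast intro: right_ideal_mult)
qed

lemma set_add_upper_left:
  "right_ideal I R \<Longrightarrow> right_ideal K R \<Longrightarrow> I \<subseteq> I <+> K"
  unfolding mem_set_add_iff subset_iff
  by (metis r_zero right_ideal_zero right_ideal_in_carrier)

lemma set_add_upper_right:
  "right_ideal I R \<Longrightarrow> right_ideal K R \<Longrightarrow> K \<subseteq> I <+> K"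
  unfolding mem_set_add_iff subset_iff
  by (metis l_zero right_ideal_zero right_ideal_in_carrier)

text \<open>A right ideal is everything as soon as it contains \<open>\<one>\<close>. This turns
  comaximality into one equation between elements, the form in which it is used below.\<close>

lemma set_add_eq_carrier_iff:
  assumes "right_ideal I R" "right_ideal K R"
  shows "I <+> K = carrier R \<longleftrightarrow> (\<exists>i\<in>I. \<exists>k\<in>K. \<one> = i \<oplus> k)"
  using right_ideal_eq_carrier[OF right_ideal_set_add[OF assms]]
  by (metis mem_set_add_iff one_closed)

definition right_multiples :: "'a \<Rightarrow> 'a set" where
  "right_multiples x = (\<lambda>r. x \<otimes> r) ` carrier R"

lemma right_ideal_multiples:
  assumes "x \<in> carrier R"
  shows "right_ideal (right_multiples x) R"
proof (rule right_idealI)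
  show "right_multiples x \<subseteq> carrier R" using assms by (auto simp: right_multiples_def)
  show "\<zero> \<in> right_multiples x"
    using assms by (auto simp: right_multiples_def intro!: image_eqI[of _ _ \<zero>])
next
  fix y z assume "y \<in> right_multiples x" "z \<in> right_multiples x"
  then show "y \<oplus> z \<in> right_multiples x"
    using assms by (auto simp: right_multiples_def r_distr[symmetric])
next
  fix y r assume "y \<in> right_multiples x" "r \<in> carrier R"
  then show "y \<otimes> r \<in> right_multiples x"
    using assms by (auto simp: right_multiples_def m_assoc)
qed

lemma right_multiples_self: "x \<in> carrier R \<Longrightarrow> x \<in> right_multiples x"
  by (auto simp: right_multiples_def intro!: image_eqI[of _ _ \<one>])

lemma right_multiples_subset: "right_ideal I R \<Longrightarrow> x \<in> I \<Longrightarrow> right_multiples x \<subseteq> I"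
  by (auto simp: right_multiples_def right_ideal_mult)

section \<open>Zorn's lemma and maximal right ideals\<close>

lemma right_ideal_Union_chain:
  assumes "C \<noteq> {}" and C: "\<And>X. X \<in> C \<Longrightarrow> right_ideal X R"
    and chain: "\<And>X Y. X \<in> C \<Longrightarrow> Y \<in> C \<Longrightarrow> X \<subseteq> Y \<or> Y \<subseteq> X"
  shows "right_ideal (\<Union>C) R"
proof (rule right_idealI)
  show "\<Union>C \<subseteq> carrier R" using C right_ideal_subset by blast
  show "\<zero> \<in> \<Union>C" using assms(1) C right_ideal_zero by blast
next
  fix x y assume "x \<in> \<Union>C" "y \<in> \<Union>C"
  then obtain X Y where "X \<in> C" "Y \<in> C" "x \<in> X" "y \<in> Y" by auto
  then show "x \<oplus> y \<in> \<Union>C" using chain[of X Y] C right_ideal_add by blast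
next
  fix x r assume "x \<in> \<Union>C" "r \<in> carrier R"
  then show "x \<otimes> r \<in> \<Union>C" using C right_ideal_mult by blast
qed

text \<open>The set \<open>A\<close> to be avoided is a parameter because three choices occur:
  \<open>{\<one>}\<close> for maximal right ideals, \<open>{b}\<close> for a right ideal maximal
  without \<open>b\<close>, and, over the opposite ring, the nonzero elements of a left annihilator
  for minimal complements.\<close>

lemma right_ideal_Zorn:
  assumes I: "right_ideal I R" and IA: "I \<inter> A = {}"
  obtains M where "right_ideal M R" "I \<subseteq> M" "M \<inter> A = {}"
    "\<And>K. right_ideal K R \<Longrightarrow> M \<subseteq> K \<Longrightarrow> K \<inter> A = {} \<Longrightarrow> K = M"
proof -
  let ?F = "{K. right_ideal K R \<and> I \<subseteq> K \<and> K \<inter> A = {}}"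
  have "\<exists>M\<in>?F. \<forall>X\<in>?F. M \<subseteq> X \<longrightarrow> X = M"
  proof (rule subset_Zorn_nonempty)
    show "?F \<noteq> {}" using assms by auto
  next
    fix C assume ne: "C \<noteq> {}" and ch: "subset.chain ?F C"
    have CF: "\<And>X. X \<in> C \<Longrightarrow> right_ideal X R" "\<And>X. X \<in> C \<Longrightarrow> I \<subseteq> X"
        "\<And>X. X \<in> C \<Longrightarrow> X \<inter> A = {}"
      using ch by (auto simp: subset_chain_def)
    have "right_ideal (\<Union>C) R"
      using ne CF(1) ch by (intro right_ideal_Union_chain) (auto simp: subset_chain_def)
    then show "\<Union>C \<in> ?F" using ne CF(2,3) by fast
  qed
  then obtain M where "right_ideal M R" "I \<subseteq> M" "M \<inter> A = {}"
    "\<forall>X\<in>?F. M \<subseteq> X \<longrightarrow> X = M" by blast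
  then show thesis by (intro that[of M]) auto
qed

lemma exists_maximal_right_ideal:
  assumes "right_ideal I R" "I \<noteq> carrier R"
  obtains M where "maximal_right_ideal M R" "I \<subseteq> M"
proof -
  have "I \<inter> {\<one>} = {}" using assms right_ideal_eq_carrier by blast
  then obtain M where M: "right_ideal M R" "I \<subseteq> M" "M \<inter> {\<one>} = {}"
    "\<And>K. right_ideal K R \<Longrightarrow> M \<subseteq> K \<Longrightarrow> K \<inter> {\<one>} = {} \<Longrightarrow> K = M"
    using right_ideal_Zorn[OF assms(1)] by metis
  then have "maximal_right_ideal M R"
    unfolding maximal_right_ideal_def using right_ideal_eq_carrier one_closed by blast
  then show thesis using M that by blast
qed

lemma maximal_right_ideal_complement:
  assumes M: "maximal_right_ideal M R" and x: "x \<in> carrier R" "x \<notin> M"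
  obtains m r where "m \<in> M" "r \<in> carrier R" "\<one> = m \<oplus> x \<otimes> r"
proof -
  have rM: "right_ideal M R" using M by (simp add: maximal_right_ideal_def)
  note rx = right_ideal_multiples[OF x(1)]
  have "x \<in> M <+> right_multiples x"
    using set_add_upper_right[OF rM rx] right_multiples_self[OF x(1)] by auto
  then have "M <+> right_multiples x = carrier R"
    using M x(2) right_ideal_set_add[OF rM rx] set_add_upper_left[OF rM rx]
    unfolding maximal_right_ideal_def by metis
  then show thesis
    using that unfolding set_add_eq_carrier_iff[OF rM rx] by (auto simp: right_multiples_def)
qed

end

section \<open>The opposite ring\<close>

text \<open>Only the field \<open>mult\<close> is updated, so \<open>op_ring (op_ring R) = R\<close>
  is an equation of records and everything built from addition alone is unchanged. The simp rules
  below then turn a right-sided lemma into its left-sided version.\<close>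

definition op_ring :: "('a, 'b) ring_scheme \<Rightarrow> ('a, 'b) ring_scheme" where
  "op_ring R = R\<lparr>mult := \<lambda>x y. y \<otimes>\<^bsub>R\<^esub> x\<rparr>"

lemma op_ring_simps [simp]:
  "carrier (op_ring R) = carrier R"
  "x \<otimes>\<^bsub>op_ring R\<^esub> y = y \<otimes>\<^bsub>R\<^esub> x"
  "\<one>\<^bsub>op_ring R\<^esub> = \<one>\<^bsub>R\<^esub>"
  "\<zero>\<^bsub>op_ring R\<^esub> = \<zero>\<^bsub>R\<^esub>"
  "add (op_ring R) = add R"
  by (simp_all add: op_ring_def)

lemma op_ring_op_ring [simp]: "op_ring (op_ring R) = R"
  by (simp add: op_ring_def)

lemma op_ring_additive [simp]:
  "a_inv (op_ring R) = a_inv R"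
  "a_minus (op_ring R) = a_minus R"
  "set_add (op_ring R) = set_add R"
  "a_r_coset (op_ring R) = a_r_coset R"
  "a_rcosets\<^bsub>op_ring R\<^esub> I = a_rcosets\<^bsub>R\<^esub> I"
  "additive_subgroup I (op_ring R) = additive_subgroup I R"
  by (simp_all add: a_inv_def a_minus_def fun_eq_iff set_add_def set_mult_def a_r_coset_def r_coset_def
      A_RCOSETS_def RCOSETS_def additive_subgroup_def)

lemma (in ring) ring_op_ring: "ring (op_ring R)"
  by (rule ringI)
    (auto intro!: monoidI abelian_groupI simp: l_distr r_distr m_assoc a_ac intro: add.l_inv_ex)

lemma op_ring_ideals [simp]:
  "right_ideal I (op_ring R) = left_ideal I R"
  "left_ideal I (op_ring R) = right_ideal I R"
  "r_ann (op_ring R) = l_ann R"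
  "l_ann (op_ring R) = r_ann R"
  by (auto simp: right_ideal_def left_ideal_def r_ann_def l_ann_def fun_eq_iff)

lemma op_ring_classes [simp]:
  "right_annihilator I (op_ring R) = left_annihilator I R"
  "left_annihilator I (op_ring R) = right_annihilator I R"
  "small_right_ideal I (op_ring R) = small_left_ideal I R"
  "small_left_ideal I (op_ring R) = small_right_ideal I R"
  "maximal_right_ideal I (op_ring R) = maximal_left_ideal I R"
  "maximal_left_ideal I (op_ring R) = maximal_right_ideal I R"
  "simple_right_ideal I (op_ring R) = simple_left_ideal I R"
  "simple_left_ideal I (op_ring R) = simple_right_ideal I R"
  "right_module_hom (op_ring R) I f = left_module_hom R I f"
  "left_module_hom (op_ring R) I f = right_module_hom R I f"
  by (simp_all add: right_annihilator_def left_annihilator_def small_right_ideal_def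
      small_left_ideal_def maximal_right_ideal_def maximal_left_ideal_def simple_right_ideal_def
      simple_left_ideal_def right_module_hom_def left_module_hom_def)

lemma op_ring_properties [simp]:
  "right_dual (op_ring R) = left_dual R"
  "left_dual (op_ring R) = right_dual R"
  "right_small_dual (op_ring R) = left_small_dual R"
  "left_small_dual (op_ring R) = right_small_dual R"
  "right_artinian (op_ring R) = left_artinian R"
  "left_artinian (op_ring R) = right_artinian R"
  "right_kasch (op_ring R) = left_kasch R"
  "right_simple_injective (op_ring R) = left_simple_injective R"
  by (simp_all add: right_dual_def left_dual_def right_small_dual_def left_small_dual_def
      right_artinian_def left_artinian_def right_kasch_def left_kasch_def
      right_simple_injective_def left_simple_injective_def)

text \<open>The product of cosets is formed from the products of their elements, so swapping factors
  in the ring swaps them in the quotient. With it, conditions on the left ideals of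
  \<open>R/J\<close> become conditions on a quotient of the opposite ring.\<close>

lemma op_ring_Quot: "op_ring (R Quot I) = op_ring R Quot I"
  unfolding op_ring_def[of "R Quot I"] by (auto simp: FactRing_def rcoset_mult_def fun_eq_iff)

context ring
begin

section \<open>Annihilators\<close>

lemma right_ideal_r_ann: "X \<subseteq> carrier R \<Longrightarrow> right_ideal (r_ann R X) R"
  by (rule right_idealI) (auto simp: r_ann_def r_distr m_assoc[symmetric])

lemma left_ideal_l_ann: "X \<subseteq> carrier R \<Longrightarrow> left_ideal (l_ann R X) R"
  using ring.right_ideal_r_ann[OF ring_op_ring, of X] by simp

lemma l_ann_subset: "l_ann R X \<subseteq> carrier R"
  by (auto simp: l_ann_def)

lemma r_ann_antimono: "X \<subseteq> Y \<Longrightarrow> r_ann R Y \<subseteq> r_ann R X"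
  by (auto simp: r_ann_def)

lemma l_ann_antimono: "X \<subseteq> Y \<Longrightarrow> l_ann R Y \<subseteq> l_ann R X"
  by (auto simp: l_ann_def)

lemma subset_r_ann_l_ann: "X \<subseteq> carrier R \<Longrightarrow> X \<subseteq> r_ann R (l_ann R X)"
  by (auto simp: r_ann_def l_ann_def)

lemma subset_l_ann_r_ann: "X \<subseteq> carrier R \<Longrightarrow> X \<subseteq> l_ann R (r_ann R X)"
  by (auto simp: r_ann_def l_ann_def)

text \<open>The two annihilators form a Galois connection, whence \<open>r(l(r(X))) = r(X)\<close>;
  the witness \<open>X\<close> can always be taken to be \<open>l(I)\<close>.\<close>

lemma right_annihilator_iff:
  assumes "I \<subseteq> carrier R"
  shows "right_annihilator I R \<longleftrightarrow> r_ann R (l_ann R I) = I"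
proof
  assume "right_annihilator I R"
  then obtain X where X: "X \<subseteq> carrier R" "I = r_ann R X" by (auto simp: right_annihilator_def)
  then have "r_ann R (l_ann R I) \<subseteq> I"
    using r_ann_antimono[OF subset_l_ann_r_ann[OF X(1)]] by simp
  then show "r_ann R (l_ann R I) = I" using subset_r_ann_l_ann[OF assms] by simp
next
  assume "r_ann R (l_ann R I) = I"
  then show "right_annihilator I R"
    using l_ann_subset unfolding right_annihilator_def by metis
qed

lemma right_annihilatorD:
  "right_annihilator I R \<Longrightarrow> right_ideal I R \<Longrightarrow> r_ann R (l_ann R I) = I"
  using right_annihilator_iff right_ideal_subset by blast

lemma r_ann_zero: "r_ann R {\<zero>} = carrier R"
  by (auto simp: r_ann_def)

lemma l_ann_carrier: "l_ann R (carrier R) = {\<zero>}"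
  by (auto simp: l_ann_def) (metis r_one one_closed)

lemma l_ann_set_add:
  assumes I: "right_ideal I R" and K: "right_ideal K R"
  shows "l_ann R (I <+> K) = l_ann R I \<inter> l_ann R K"
proof
  show "l_ann R (I <+> K) \<subseteq> l_ann R I \<inter> l_ann R K"
    using l_ann_antimono[OF set_add_upper_left[OF I K]] l_ann_antimono[OF set_add_upper_right[OF I K]]
    by auto
  show "l_ann R I \<inter> l_ann R K \<subseteq> l_ann R (I <+> K)"
    using right_ideal_in_carrier[OF I] right_ideal_in_carrier[OF K]
    by (auto simp: l_ann_def mem_set_add_iff r_distr)
qed

text \<open>The annihilator of a nonzero element is proper, as it omits \<open>\<one>\<close>; once
  it contains a maximal right ideal it equals it. To exhibit \<open>M\<close> as an annihilator it
  is therefore enough to find one nonzero element killing \<open>M\<close>.\<close>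

lemma maximal_right_ideal_eq_r_ann:
  assumes "maximal_right_ideal M R" "x \<in> carrier R" "x \<noteq> \<zero>" "\<And>m. m \<in> M \<Longrightarrow> x \<otimes> m = \<zero>"
  shows "M = r_ann R {x}"
proof -
  have "right_ideal (r_ann R {x}) R" using assms by (simp add: right_ideal_r_ann)
  moreover have "M \<subseteq> r_ann R {x}"
    using assms right_ideal_in_carrier by (auto simp: r_ann_def maximal_right_ideal_def)
  moreover have "\<one> \<notin> r_ann R {x}" using assms by (simp add: r_ann_def)
  ultimately show ?thesis using assms(1) unfolding maximal_right_ideal_def by blast
qed

section \<open>The Jacobson radical\<close>

text \<open>Jacobson's lemma. The inverse \<open>\<one> \<oplus> b \<otimes> u \<otimes> a\<close>
  is suggested by the geometric series: \<open>1 + ba + baba + ...\<close> equals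
  \<open>1 + b(1 + ab + ...)a\<close>. It is the source of the left-right symmetry of the
  radical.\<close>

lemma one_minus_mult_commute_Units:
  assumes [simp]: "a \<in> carrier R" "b \<in> carrier R" and u: "\<one> \<ominus> a \<otimes> b \<in> Units R"
  shows "\<one> \<ominus> b \<otimes> a \<in> Units R"
proof -
  define u where "u = inv (\<one> \<ominus> a \<otimes> b)"
  have [simp]: "u \<in> carrier R" and lr: "(\<one> \<ominus> a \<otimes> b) \<otimes> u = \<one>" "u \<otimes> (\<one> \<ominus> a \<otimes> b) = \<one>"
    using u by (auto simp: u_def)
  have "(\<one> \<ominus> b \<otimes> a) \<otimes> (\<one> \<oplus> b \<otimes> u \<otimes> a) = \<one> \<ominus> b \<otimes> a \<oplus> b \<otimes> ((\<one> \<ominus> a \<otimes> b) \<otimes> u) \<otimes> a"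
    by (simp add: minus_eq l_distr r_distr l_minus r_minus m_assoc a_ac minus_add)
  also have "\<dots> = \<one>" unfolding lr by (simp add: minus_eq a_ac r_neg l_neg)
  finally have 1: "(\<one> \<ominus> b \<otimes> a) \<otimes> (\<one> \<oplus> b \<otimes> u \<otimes> a) = \<one>" .
  have "(\<one> \<oplus> b \<otimes> u \<otimes> a) \<otimes> (\<one> \<ominus> b \<otimes> a) = \<one> \<ominus> b \<otimes> a \<oplus> b \<otimes> (u \<otimes> (\<one> \<ominus> a \<otimes> b)) \<otimes> a"
    by (simp add: minus_eq l_distr r_distr l_minus r_minus m_assoc a_ac minus_add)
  also have "\<dots> = \<one>" unfolding lr by (simp add: minus_eq a_ac r_neg l_neg)
  finally have 2: "(\<one> \<oplus> b \<otimes> u \<otimes> a) \<otimes> (\<one> \<ominus> b \<otimes> a) = \<one>" .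
  show ?thesis using 1 2 unfolding Units_def
    by (auto intro!: bexI[of _ "\<one> \<oplus> b \<otimes> u \<otimes> a"])
qed

lemma right_ideal_jacobson_radical: "right_ideal (jacobson_radical R) R"
  by (rule right_idealI)
    (auto simp: jacobson_radical_def maximal_right_ideal_def
      intro: right_ideal_zero right_ideal_add right_ideal_mult)

text \<open>The definition by maximal right ideals is one-sided; a criterion in terms of two-sided
  units can be compared with its mirror image.\<close>

lemma jacobson_radical_iff:
  "x \<in> jacobson_radical R \<longleftrightarrow> x \<in> carrier R \<and> (\<forall>r\<in>carrier R. \<one> \<ominus> x \<otimes> r \<in> Units R)"
proof -
  \<comment> \<open>A maximal right ideal containing \<open>\<one> \<ominus> y\<close> would also
    contain \<open>y\<close>, hence \<open>\<one>\<close>.\<close>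
  have right_inverse: "\<exists>s\<in>carrier R. (\<one> \<ominus> y) \<otimes> s = \<one>" if y: "y \<in> jacobson_radical R" for y
  proof -
    have yc [simp]: "y \<in> carrier R" using y by (simp add: jacobson_radical_def)
    note rI = right_ideal_multiples[of "\<one> \<ominus> y"]
    have "right_multiples (\<one> \<ominus> y) = carrier R"
    proof (rule ccontr)
      assume "right_multiples (\<one> \<ominus> y) \<noteq> carrier R"
      then obtain M where M: "maximal_right_ideal M R" "right_multiples (\<one> \<ominus> y) \<subseteq> M"
        using exists_maximal_right_ideal[OF rI] by auto
      then have rM: "right_ideal M R" and "M \<noteq> carrier R" by (auto simp: maximal_right_ideal_def)
      have "\<one> \<ominus> y \<in> M" using M(2) right_multiples_self[of "\<one> \<ominus> y"] by auto
      moreover have "y \<in> M" using y M(1) by (auto simp: jacobson_radical_def)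
      ultimately have "(\<one> \<ominus> y) \<oplus> y \<in> M" using right_ideal_add[OF rM] by blast
      moreover have "(\<one> \<ominus> y) \<oplus> y = \<one>" by (simp add: minus_eq a_assoc l_neg)
      ultimately show False using \<open>M \<noteq> carrier R\<close> right_ideal_eq_carrier[OF rM] by simp
    qed
    then have "\<one> \<in> (\<lambda>r. (\<one> \<ominus> y) \<otimes> r) ` carrier R" by (simp add: right_multiples_def)
    then show ?thesis by (metis imageE)
  qed
  have unit: "\<one> \<ominus> y \<in> Units R" if y: "y \<in> jacobson_radical R" for y
  proof -
    have yc [simp]: "y \<in> carrier R" using y by (simp add: jacobson_radical_def)
    obtain s where s [simp]: "s \<in> carrier R" and ys: "(\<one> \<ominus> y) \<otimes> s = \<one>"
      using right_inverse[OF y] by auto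
    \<comment> \<open>The right inverse \<open>s\<close> is itself \<open>\<one>\<close> minus an
      element of the radical, so it has a right inverse \<open>t\<close> in turn. Having
      \<open>\<one> \<ominus> y\<close> on its left and \<open>t\<close> on its right,
      \<open>s\<close> forces the two to agree, and so is a two-sided inverse.\<close>
    have "s = (\<one> \<ominus> y) \<otimes> s \<oplus> y \<otimes> s"
      by (simp add: minus_eq l_distr l_minus a_assoc l_neg)
    also have "\<dots> = \<one> \<ominus> y \<otimes> (\<ominus> s)" unfolding ys by (simp add: minus_eq r_minus)
    finally have s_eq: "s = \<one> \<ominus> y \<otimes> (\<ominus> s)" .
    have "y \<otimes> (\<ominus> s) \<in> jacobson_radical R"
      using right_ideal_mult[OF right_ideal_jacobson_radical y] by simp
    then obtain t where t [simp]: "t \<in> carrier R" and st: "s \<otimes> t = \<one>"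
      using right_inverse s_eq by metis
    have "t = (\<one> \<ominus> y) \<otimes> s \<otimes> t" using ys by simp
    also have "\<dots> = \<one> \<ominus> y" using st by (simp add: m_assoc)
    finally have "s \<otimes> (\<one> \<ominus> y) = \<one>" using st by simp
    then show ?thesis using ys by (auto simp: Units_def intro!: bexI[of _ s])
  qed
  show ?thesis
  proof safe
    assume x: "x \<in> jacobson_radical R"
    then show "x \<in> carrier R" by (simp add: jacobson_radical_def)
    show "\<one> \<ominus> x \<otimes> r \<in> Units R" if "r \<in> carrier R" for r
      using unit right_ideal_mult[OF right_ideal_jacobson_radical x that] by blast
  next
    assume x: "x \<in> carrier R" and u: "\<forall>r\<in>carrier R. \<one> \<ominus> x \<otimes> r \<in> Units R"
    have "x \<in> M" if M: "maximal_right_ideal M R" for M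
    proof (rule ccontr)
      assume "x \<notin> M"
      then obtain m r where mr: "m \<in> M" "r \<in> carrier R" "\<one> = m \<oplus> x \<otimes> r"
        using maximal_right_ideal_complement[OF M x] by blast
      have rM: "right_ideal M R" using M by (simp add: maximal_right_ideal_def)
      have mc: "m \<in> carrier R" using right_ideal_in_carrier[OF rM] mr by simp
      have "\<one> \<ominus> x \<otimes> r = m"
        unfolding mr(3) using x mr(2) mc by (simp add: minus_eq a_assoc r_neg)
      then have "m \<in> Units R" using u mr(2) by auto
      then have "m \<otimes> inv m = \<one>" "inv m \<in> carrier R" by auto
      then have "\<one> \<in> M" using right_ideal_mult[OF rM mr(1)] by metis
      then show False using right_ideal_eq_carrier[OF rM] M by (simp add: maximal_right_ideal_def)
    qed
    then show "x \<in> jacobson_radical R" using x by (simp add: jacobson_radical_def)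
  qed
qed

end

text \<open>In the unit criterion \<open>\<one> \<ominus> x \<otimes> r\<close> and
  \<open>\<one> \<ominus> r \<otimes> x\<close> are units together, by Jacobson's lemma. Hence the
  radical is a two-sided ideal, and one \<open>J\<close> serves for both sides.\<close>

lemma (in ring) jacobson_radical_op_ring [simp]:
  "jacobson_radical (op_ring R) = jacobson_radical R"
proof -
  have "Units (op_ring R) = Units R" by (auto simp: Units_def)
  then show ?thesis
    using one_minus_mult_commute_Units
    by (auto simp: ring.jacobson_radical_iff[OF ring_op_ring] jacobson_radical_iff)
qed

context ring
begin

section \<open>The radical as a two-sided ideal, small ideals and minimal complements\<close>

lemma left_ideal_jacobson_radical: "left_ideal (jacobson_radical R) R"
  using ring.right_ideal_jacobson_radical[OF ring_op_ring] by simp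

lemma jacobson_radical_subset: "jacobson_radical R \<subseteq> carrier R"
  by (auto simp: jacobson_radical_def)

lemma ideal_jacobson_radical: "ideal (jacobson_radical R) R"
  using right_ideal_jacobson_radical left_ideal_jacobson_radical ring_axioms
  by (auto intro!: idealI simp: right_ideal_def left_ideal_def additive_subgroup_def)

text \<open>If \<open>\<one> = i \<oplus> k\<close> with \<open>i\<close> in the radical, then
  \<open>k\<close> is a unit. Small duality is exploited only through this lemma, that is, for
  ideals inside the radical.\<close>

lemma small_right_ideal_subset_jacobson_radical:
  assumes I: "right_ideal I R" and IJ: "I \<subseteq> jacobson_radical R"
  shows "small_right_ideal I R"
proof -
  have "K = carrier R" if K: "right_ideal K R" and IK: "I <+> K = carrier R" for K
  proof -
    obtain i k where ik: "i \<in> I" "k \<in> K" "\<one> = i \<oplus> k"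
      using IK set_add_eq_carrier_iff[OF I K] by auto
    have [simp]: "i \<in> carrier R" "k \<in> carrier R"
      using ik I K right_ideal_in_carrier by auto
    have "(i \<oplus> k) \<ominus> i = k" by (simp add: minus_eq a_assoc a_comm[of k "\<ominus> i"] r_neg2)
    then have "k = \<one> \<ominus> i \<otimes> \<one>" using ik(3)[symmetric] by simp
    moreover have "\<one> \<ominus> i \<otimes> \<one> \<in> Units R"
      using ik(1) IJ jacobson_radical_iff one_closed by blast
    ultimately have "k \<in> Units R" by metis
    then have "k \<otimes> inv k = \<one>" "inv k \<in> carrier R" by auto
    then have "\<one> \<in> K" using right_ideal_mult[OF K ik(2)] by metis
    then show ?thesis using right_ideal_eq_carrier[OF K] by simp
  qed
  then show ?thesis using I by (auto simp: small_right_ideal_def)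
qed

text \<open>If some \<open>x\<close> in the intersection missed a maximal right ideal \<open>M\<close>, then \<open>K \<inter> M\<close>
  would be a smaller complement of \<open>I\<close>, as \<open>M + xR = R\<close>.\<close>

lemma minimal_complement_Int_subset_jacobson_radical:
  assumes I: "right_ideal I R" and K: "right_ideal K R" and IK: "I <+> K = carrier R"
    and min: "\<And>K'. right_ideal K' R \<Longrightarrow> K' \<subseteq> K \<Longrightarrow> K \<inter> jacobson_radical R \<subseteq> K' \<Longrightarrow>
      I <+> K' = carrier R \<Longrightarrow> K' = K"
  shows "I \<inter> K \<subseteq> jacobson_radical R"
proof
  fix x assume x: "x \<in> I \<inter> K"
  then have xc: "x \<in> carrier R" using right_ideal_in_carrier[OF I] by auto
  have "x \<in> M" if M: "maximal_right_ideal M R" for M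
  proof (rule ccontr)
    assume "x \<notin> M"
    then obtain m r where mr: "m \<in> M" "r \<in> carrier R" "\<one> = m \<oplus> x \<otimes> r"
      using maximal_right_ideal_complement[OF M xc] by blast
    have rM: "right_ideal M R" using M by (simp add: maximal_right_ideal_def)
    obtain i k where ik: "i \<in> I" "k \<in> K" "\<one> = i \<oplus> k"
      using IK set_add_eq_carrier_iff[OF I K] by auto
    have c [simp]: "i \<in> carrier R" "k \<in> carrier R" "m \<in> carrier R" "x \<in> carrier R" "r \<in> carrier R"
      using ik I K rM xc mr right_ideal_in_carrier by auto
    have k: "k = m \<otimes> k \<oplus> x \<otimes> r \<otimes> k"
      using mr(3)[symmetric] by (simp add: l_distr[symmetric])
    have xrk: "x \<otimes> r \<otimes> k \<in> I" "x \<otimes> r \<otimes> k \<in> K"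
      using x I K by (auto intro!: right_ideal_mult)
    have "k \<ominus> x \<otimes> r \<otimes> k = m \<otimes> k"
      by (subst (1) k) (simp add: minus_eq a_assoc r_neg)
    then have "m \<otimes> k \<in> K \<inter> M"
      using right_ideal_minus[OF K ik(2) xrk(2)] right_ideal_mult[OF rM mr(1)] by auto
    moreover have "i \<oplus> x \<otimes> r \<otimes> k \<in> I" using right_ideal_add[OF I ik(1) xrk(1)] .
    moreover have "\<one> = (i \<oplus> x \<otimes> r \<otimes> k) \<oplus> m \<otimes> k"
      unfolding ik(3) by (subst (1) k) (simp add: a_ac)
    ultimately have "I <+> (K \<inter> M) = carrier R"
      using set_add_eq_carrier_iff[OF I right_ideal_Int[OF K rM]] by blast
    \<comment> \<open>The smaller complement still contains \<open>K \<inter> J\<close>. Minimality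
      is assumed only among such complements because an argument in \<open>R/J\<close> sees only
      right ideals containing \<open>J\<close>.\<close>
    moreover have "K \<inter> jacobson_radical R \<subseteq> K \<inter> M" using M by (auto simp: jacobson_radical_def)
    ultimately have "K \<inter> M = K" using min[OF right_ideal_Int[OF K rM]] by auto
    then show False using x \<open>x \<notin> M\<close> by auto
  qed
  then show "x \<in> jacobson_radical R" using xc by (simp add: jacobson_radical_def)
qed

end

context ring
begin

section \<open>Simple injectivity\<close>

text \<open>If \<open>I\<close> were not a right annihilator, a simple quotient of a cyclic submodule of \<open>R/I\<close>
  would embed into \<open>R\<close>, and the embedding would be induced by left multiplication with an
  element \<open>c\<close> of \<open>l(I)\<close> that does not annihilate \<open>r(l(I))\<close>.\<close>

lemma right_dual_if_kasch_simple_injective: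
  assumes kasch: "right_kasch R" and inj: "right_simple_injective R"
  shows "right_dual R"
proof -
  have "r_ann R (l_ann R I) \<subseteq> I" if I: "right_ideal I R" for I
  proof
    fix b assume b: "b \<in> r_ann R (l_ann R I)"
    then have bc [simp]: "b \<in> carrier R" by (simp add: r_ann_def)
    show "b \<in> I"
    proof (rule ccontr)
      assume "b \<notin> I"
      then obtain M where M: "right_ideal M R" "I \<subseteq> M" "b \<notin> M"
        and max: "\<And>K. right_ideal K R \<Longrightarrow> M \<subseteq> K \<Longrightarrow> b \<notin> K \<Longrightarrow> K = M"
        using right_ideal_Zorn[OF I, of "{b}"] by auto
      note Mc [simp] = right_ideal_in_carrier[OF M(1)]
      \<comment> \<open>\<open>N\<close> is the annihilator of the class of \<open>b\<close> in
        \<open>R/M\<close>. Every right ideal properly above \<open>M\<close> contains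
        \<open>b\<close>, so \<open>(bR + M)/M\<close> is simple and isomorphic to
        \<open>R/N\<close>.\<close>
      define N where "N = {r \<in> carrier R. b \<otimes> r \<in> M}"
      have N: "right_ideal N R"
        by (rule right_idealI)
          (auto simp: N_def r_distr m_assoc[symmetric] right_ideal_zero right_ideal_add
            right_ideal_mult M(1))
      \<comment> \<open>Maximality of \<open>N\<close> in terms of elements. It serves twice: for
        the maximality proper and for the simplicity of \<open>xR\<close>.\<close>
      have N_compl: "\<exists>n\<in>N. \<exists>s\<in>carrier R. \<one> = n \<oplus> r \<otimes> s" if r: "r \<in> carrier R" "r \<notin> N" for r
      proof -
        note br = right_ideal_multiples[of "b \<otimes> r"]
        have "b \<otimes> r \<in> M <+> right_multiples (b \<otimes> r)"
          using set_add_upper_right[OF M(1) br] right_multiples_self[of "b \<otimes> r"] r by auto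
        then have "M <+> right_multiples (b \<otimes> r) \<noteq> M" using r by (auto simp: N_def)
        then have "b \<in> M <+> right_multiples (b \<otimes> r)"
          using max[OF right_ideal_set_add[OF M(1) br] set_add_upper_left[OF M(1) br]] r by auto
        then obtain m s where ms: "m \<in> M" "s \<in> carrier R" "b = m \<oplus> b \<otimes> r \<otimes> s"
          unfolding mem_set_add_iff right_multiples_def by blast
        have "b \<otimes> (\<one> \<ominus> r \<otimes> s) = b \<ominus> b \<otimes> r \<otimes> s"
          using r ms by (simp add: minus_eq r_distr r_minus m_assoc)
        also have "\<dots> = m" using r ms(1,2)
          by (subst (1) ms(3)) (simp add: minus_eq a_assoc r_neg)
        finally have "\<one> \<ominus> r \<otimes> s \<in> N" using r ms by (simp add: N_def)
        moreover have "\<one> = (\<one> \<ominus> r \<otimes> s) \<oplus> r \<otimes> s"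
          using r ms(2) by (simp add: minus_eq a_assoc l_neg)
        ultimately show ?thesis using ms(2) by blast
      qed
      have N1: "\<one> \<notin> N" using M(3) by (simp add: N_def)
      have "maximal_right_ideal N R"
        unfolding maximal_right_ideal_def
      proof (intro conjI allI impI)
        show "N \<noteq> carrier R" using N1 by auto
        fix K assume K: "right_ideal K R \<and> N \<subseteq> K"
        show "K = N \<or> K = carrier R"
        proof (rule disjCI)
          assume "K \<noteq> carrier R"
          show "K = N"
          proof (rule ccontr)
            assume "K \<noteq> N"
            then obtain r where r: "r \<in> K" "r \<notin> N" using K by auto
            then obtain n s where ns: "n \<in> N" "s \<in> carrier R" "\<one> = n \<oplus> r \<otimes> s"
              using N_compl[OF right_ideal_in_carrier[of K]] K by metis
            have "n \<oplus> r \<otimes> s \<in> K"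
              using right_ideal_add right_ideal_mult[OF _ r(1) ns(2)] K ns(1) by blast
            then have "\<one> \<in> K" using ns(3) by simp
            then show False using \<open>K \<noteq> carrier R\<close> right_ideal_eq_carrier K by blast
          qed
        qed
      qed (rule N)
      then have rl: "r_ann R (l_ann R N) = N"
        using kasch right_annihilatorD N by (simp add: right_kasch_def)
      have "\<exists>x\<in>l_ann R N. x \<noteq> \<zero>"
      proof (rule ccontr)
        assume "\<not> ?thesis"
        then have "\<one> \<in> r_ann R (l_ann R N)" by (auto simp: r_ann_def)
        then show False using rl N1 by simp
      qed
      then obtain x where x: "x \<in> carrier R" "x \<noteq> \<zero>" "\<And>n. n \<in> N \<Longrightarrow> x \<otimes> n = \<zero>"
        by (auto simp: l_ann_def)
      define P where "P = right_multiples b <+> M"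
      \<comment> \<open>The map \<open>br + m \<mapsto> xr\<close>. Two choices of \<open>r\<close>
        differ by an element of \<open>N\<close>, which \<open>x\<close> kills, so the choice made
        by \<open>SOME\<close> does not matter.\<close>
      define f where "f y = x \<otimes> (SOME r. r \<in> carrier R \<and> y \<ominus> b \<otimes> r \<in> M)" for y
      have f_eq: "f y = x \<otimes> r" if r: "r \<in> carrier R" "y \<ominus> b \<otimes> r \<in> M" and y: "y \<in> carrier R" for y r
      proof -
        define s where "s = (SOME r. r \<in> carrier R \<and> y \<ominus> b \<otimes> r \<in> M)"
        have s: "s \<in> carrier R \<and> y \<ominus> b \<otimes> s \<in> M"
          unfolding s_def by (rule someI) (use r in blast)
        have "(y \<ominus> b \<otimes> r) \<ominus> (y \<ominus> b \<otimes> s) \<in> M"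
          using right_ideal_minus[OF M(1)] r s by blast
        moreover have "(y \<ominus> b \<otimes> r) \<ominus> (y \<ominus> b \<otimes> s) = b \<otimes> (s \<ominus> r)"
          using r(1) y conjunct1[OF s] bc by algebra
        ultimately have "s \<ominus> r \<in> N" using r s by (simp add: N_def)
        then have "x \<otimes> (s \<ominus> r) = \<zero>" using x(3) by blast
        then have "x \<otimes> s \<ominus> x \<otimes> r = \<zero>" using x(1) r s by (simp add: minus_eq r_distr r_minus)
        moreover have "x \<otimes> s = (x \<otimes> s \<ominus> x \<otimes> r) \<oplus> x \<otimes> r"
          using x(1) r(1) s by (simp add: minus_eq a_assoc l_neg)
        ultimately have "x \<otimes> s = x \<otimes> r" using x(1) r(1) by simp
        then show ?thesis by (simp add: f_def s_def)
      qed
      have P: "right_ideal P R"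
        unfolding P_def using right_ideal_set_add right_ideal_multiples M(1) by simp
      have Pc: "y \<in> carrier R" if "y \<in> P" for y using right_ideal_in_carrier[OF P that] .
      have P_rep: "\<exists>r\<in>carrier R. y \<ominus> b \<otimes> r \<in> M" if y: "y \<in> P" for y
      proof -
        obtain z m where z: "z \<in> right_multiples b" and m: "m \<in> M" "y = z \<oplus> m"
          using y unfolding P_def mem_set_add_iff by metis
        obtain r where r: "r \<in> carrier R" "z = b \<otimes> r"
          using z unfolding right_multiples_def by (rule imageE)
        have "(b \<otimes> r \<oplus> m) \<ominus> b \<otimes> r = m"
          using r(1) Mc[OF m(1)] by (simp add: minus_eq a_comm[of "b \<otimes> r" m] a_assoc r_neg)
        then have "y \<ominus> b \<otimes> r \<in> M" using r m by simp
        then show ?thesis using r(1) by blast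
      qed
      have bP: "b \<in> P" unfolding P_def
        using set_add_upper_left[OF right_ideal_multiples M(1), of b] right_multiples_self[of b]
        by auto
      have MP: "M \<subseteq> P" unfolding P_def
        using set_add_upper_right[OF right_ideal_multiples M(1)] by simp
      have f_img: "f ` P = right_multiples x"
      proof
        show "f ` P \<subseteq> right_multiples x"
        proof (rule image_subsetI)
          fix y assume y: "y \<in> P"
          then obtain r where r: "r \<in> carrier R" "y \<ominus> b \<otimes> r \<in> M" using P_rep by blast
          show "f y \<in> right_multiples x"
            unfolding right_multiples_def f_eq[OF r Pc[OF y]] using r(1) by blast
        qed
        show "right_multiples x \<subseteq> f ` P"
        proof
          fix z assume "z \<in> right_multiples x"
          then obtain r where r: "r \<in> carrier R" "z = x \<otimes> r" by (auto simp: right_multiples_def)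
          then have "f (b \<otimes> r) = z"
            using f_eq[of r "b \<otimes> r"] right_ideal_zero[OF M(1)] by (simp add: minus_eq r_neg)
          then show "z \<in> f ` P" using right_ideal_mult[OF P bP r(1)] by blast
        qed
      qed
      have f_hom: "right_module_hom R P f"
        unfolding right_module_hom_def
      proof (intro conjI ballI)
        show "f \<in> P \<rightarrow> carrier R"
          using f_img right_ideal_subset[OF right_ideal_multiples[OF x(1)]] by auto
      next
        fix y z assume y: "y \<in> P" and z: "z \<in> P"
        obtain r where r: "r \<in> carrier R" "y \<ominus> b \<otimes> r \<in> M" using P_rep[OF y] by auto
        obtain s where s: "s \<in> carrier R" "z \<ominus> b \<otimes> s \<in> M" using P_rep[OF z] by auto
        have "(y \<ominus> b \<otimes> r) \<oplus> (z \<ominus> b \<otimes> s) \<in> M" using right_ideal_add[OF M(1) r(2) s(2)] .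
        moreover have "(y \<ominus> b \<otimes> r) \<oplus> (z \<ominus> b \<otimes> s) = (y \<oplus> z) \<ominus> b \<otimes> (r \<oplus> s)"
          using r(1) s(1) Pc[OF y] Pc[OF z] bc by algebra
        ultimately have "f (y \<oplus> z) = x \<otimes> (r \<oplus> s)"
          using f_eq[of "r \<oplus> s"] r(1) s(1) Pc[OF y] Pc[OF z] by simp
        then show "f (y \<oplus> z) = f y \<oplus> f z"
          using f_eq[OF r Pc[OF y]] f_eq[OF s Pc[OF z]] r(1) s(1) x(1) by (simp add: r_distr)
      next
        fix y t assume y: "y \<in> P" and t: "t \<in> carrier R"
        obtain r where r: "r \<in> carrier R" "y \<ominus> b \<otimes> r \<in> M" using P_rep[OF y] by auto
        have "(y \<ominus> b \<otimes> r) \<otimes> t \<in> M" using right_ideal_mult[OF M(1) r(2) t] .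
        moreover have "(y \<ominus> b \<otimes> r) \<otimes> t = y \<otimes> t \<ominus> b \<otimes> (r \<otimes> t)"
          using r(1) t Pc[OF y] bc by algebra
        ultimately have "f (y \<otimes> t) = x \<otimes> (r \<otimes> t)"
          using f_eq[of "r \<otimes> t"] r(1) t Pc[OF y] by simp
        then show "f (y \<otimes> t) = f y \<otimes> t"
          using f_eq[OF r Pc[OF y]] r(1) t x(1) by (simp add: m_assoc)
      qed
      have "simple_right_ideal (f ` P) R"
        unfolding f_img simple_right_ideal_def
      proof (intro conjI allI impI)
        show "right_ideal (right_multiples x) R" using right_ideal_multiples x(1) .
        show "right_multiples x \<noteq> {\<zero>}" using right_multiples_self[OF x(1)] x(2) by auto
        fix K assume K: "right_ideal K R \<and> K \<subseteq> right_multiples x"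
        show "K = {\<zero>} \<or> K = right_multiples x"
        proof (rule disjCI)
          assume K': "K \<noteq> right_multiples x"
          have "k = \<zero>" if k: "k \<in> K" for k
          proof (rule ccontr)
            assume "k \<noteq> \<zero>"
            obtain r where r: "r \<in> carrier R" "k = x \<otimes> r"
              using k K unfolding right_multiples_def by blast
            then have "r \<notin> N" using x(3) \<open>k \<noteq> \<zero>\<close> by auto
            then obtain n s where ns: "n \<in> N" "s \<in> carrier R" "\<one> = n \<oplus> r \<otimes> s"
              using N_compl r by blast
            have nc: "n \<in> carrier R" using ns by (simp add: N_def)
            have "x = x \<otimes> (n \<oplus> r \<otimes> s)" using ns(3)[symmetric] x(1) by simp
            also have "\<dots> = k \<otimes> s"
              using ns nc r x by (simp add: r_distr m_assoc)
            finally have "x \<in> K" using K k ns(2) right_ideal_mult by metis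
            then show False using K K' right_multiples_subset by blast
          qed
          then show "K = {\<zero>}" using K right_ideal_zero by blast
        qed
      qed
      then obtain g where g: "right_module_hom R (carrier R) g" "\<forall>y\<in>P. g y = f y"
        using inj P f_hom unfolding right_simple_injective_def by blast
      define c where "c = g \<one>"
      have cc: "c \<in> carrier R" using g(1) by (auto simp: c_def right_module_hom_def)
      have gc: "g y = c \<otimes> y" if "y \<in> carrier R" for y
        using g(1) that unfolding c_def right_module_hom_def by (metis l_one one_closed)
      have "c \<otimes> i = \<zero>" if "i \<in> I" for i
      proof -
        have i: "i \<in> M" using that M(2) by auto
        then have "f i = x \<otimes> \<zero>"
          by (intro f_eq) (auto simp: minus_eq)
        moreover have "g i = f i" using g(2) MP i by blast
        ultimately show ?thesis using gc[OF Mc[OF i]] x(1) by simp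
      qed
      then have "c \<in> l_ann R I" using cc by (simp add: l_ann_def)
      then have "c \<otimes> b = \<zero>" using b by (simp add: r_ann_def)
      moreover have "f b = x \<otimes> \<one>"
        by (intro f_eq) (auto simp: minus_eq r_neg right_ideal_zero M(1))
      ultimately show False using g(2) gc bP x by auto
    qed
  qed
  then show ?thesis
    unfolding right_dual_def using right_annihilator_iff right_ideal_subset subset_r_ann_l_ann
    by (metis subset_antisym)
qed

section \<open>Weak supplements and the consequences of small duality\<close>

text \<open>Existence of weak supplements in the sense of module theory: \<open>K\<close> is a
  complement of \<open>I\<close> up to the radical. Stated inside \<open>R\<close>, it is what both
  semilocal and dual rings provide, and it makes \<open>R/J\<close> semisimple.\<close>

definition weakly_complemented :: bool where
  "weakly_complemented \<longleftrightarrow> (\<forall>I. right_ideal I R \<longrightarrow>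
     (\<exists>K. right_ideal K R \<and> I <+> K = carrier R \<and> I \<inter> K \<subseteq> jacobson_radical R))"

text \<open>Let \<open>\<one> = m \<oplus> k\<close> with \<open>k\<close> in the weak supplement of
  \<open>M\<close>. Then \<open>k\<close> is outside \<open>M\<close>, hence outside
  \<open>J = r(l(J))\<close>, so \<open>x \<otimes> k \<noteq> \<zero>\<close> for some
  \<open>x\<close> in \<open>l(J)\<close>. Since \<open>kM\<close> lies in
  \<open>M \<inter> K\<close> and so in \<open>J\<close>, the element \<open>x \<otimes> k\<close>
  kills \<open>M\<close>.\<close>

lemma right_kasch_if_small_dual:
  assumes wc: "weakly_complemented" and dual: "right_small_dual R"
  shows "right_kasch R"
  unfolding right_kasch_def
proof (intro allI impI)
  fix M assume M: "maximal_right_ideal M R"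
  then have rM: "right_ideal M R" by (simp add: maximal_right_ideal_def)
  let ?J = "jacobson_radical R"
  obtain K where K: "right_ideal K R" "M <+> K = carrier R" "M \<inter> K \<subseteq> ?J"
    using wc rM by (auto simp: weakly_complemented_def)
  then obtain m k where mk: "m \<in> M" "k \<in> K" "\<one> = m \<oplus> k"
    using set_add_eq_carrier_iff[OF rM] by blast
  have c [simp]: "m \<in> carrier R" "k \<in> carrier R"
    using mk rM K right_ideal_in_carrier by auto
  have "right_annihilator ?J R"
    using dual small_right_ideal_subset_jacobson_radical[OF right_ideal_jacobson_radical]
    by (simp add: right_small_dual_def)
  then have J: "r_ann R (l_ann R ?J) = ?J"
    using right_annihilatorD right_ideal_jacobson_radical by blast
  have "k \<notin> M"
  proof
    assume "k \<in> M"
    then have "\<one> \<in> M" using mk right_ideal_add[OF rM] by simp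
    then show False using M right_ideal_eq_carrier[OF rM] by (simp add: maximal_right_ideal_def)
  qed
  then have "k \<notin> r_ann R (l_ann R ?J)" using M J by (auto simp: jacobson_radical_def)
  then obtain x where x: "x \<in> l_ann R ?J" "x \<otimes> k \<noteq> \<zero>" by (auto simp: r_ann_def)
  have xc [simp]: "x \<in> carrier R" using x by (simp add: l_ann_def)
  have "x \<otimes> k \<otimes> m' = \<zero>" if m': "m' \<in> M" for m'
  proof -
    have m'c: "m' \<in> carrier R" using right_ideal_in_carrier[OF rM m'] .
    have "m' \<ominus> m \<otimes> m' \<in> M" using right_ideal_minus right_ideal_mult rM mk(1) m' m'c by simp
    moreover have "m' \<ominus> m \<otimes> m' = (m \<oplus> k) \<otimes> m' \<ominus> m \<otimes> m'" using mk(3)[symmetric] m'c by simp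
    moreover have "\<dots> = k \<otimes> m'" using m'c c by algebra
    ultimately have "k \<otimes> m' \<in> M" by simp
    then have "k \<otimes> m' \<in> ?J" using K mk(2) m'c right_ideal_mult by blast
    then show ?thesis using x(1) m'c by (simp add: l_ann_def m_assoc)
  qed
  then have "M = r_ann R {x \<otimes> k}"
    using maximal_right_ideal_eq_r_ann[OF M _ x(2)] by simp
  then show "right_annihilator M R"
    unfolding right_annihilator_def by (metis c(2) xc m_closed empty_subsetI insert_subset)
qed

text \<open>The kernel \<open>U\<close> of \<open>f\<close> is a right annihilator, so some \<open>d\<close> kills \<open>U\<close> but not \<open>a\<close>, where
  \<open>T = aR + U\<close>. Then \<open>da\<close> and \<open>f a\<close> have the same annihilator, and since \<open>R(da)\<close> is a left
  annihilator, \<open>f a\<close> is a left multiple of \<open>da\<close>.\<close>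

lemma simple_hom_from_radical_extends:
  assumes rdual: "right_small_dual R" and ldual: "left_small_dual R"
    and T: "right_ideal T R" and TJ: "T \<subseteq> jacobson_radical R"
    and f: "right_module_hom R T f" and simple: "simple_right_ideal (f ` T) R"
  shows "\<exists>c\<in>carrier R. \<forall>t\<in>T. f t = c \<otimes> t"
proof -
  have f_in: "\<And>x. x \<in> T \<Longrightarrow> f x \<in> carrier R"
    and f_add: "\<And>x y. x \<in> T \<Longrightarrow> y \<in> T \<Longrightarrow> f (x \<oplus> y) = f x \<oplus> f y"
    and f_mult: "\<And>x r. x \<in> T \<Longrightarrow> r \<in> carrier R \<Longrightarrow> f (x \<otimes> r) = f x \<otimes> r"
    using f by (auto simp: right_module_hom_def)
  note Tc = right_ideal_in_carrier[OF T]
  define U where "U = {x \<in> T. f x = \<zero>}"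
  have f_zero: "f \<zero> = \<zero>"
    using f_mult[OF right_ideal_zero[OF T], of \<zero>] f_in[OF right_ideal_zero[OF T]] by simp
  have U: "right_ideal U R"
    using T Tc by (intro right_idealI)
      (auto simp: U_def f_zero f_add f_mult right_ideal_zero right_ideal_add right_ideal_mult)
  have UJ: "U \<subseteq> jacobson_radical R" using TJ by (auto simp: U_def)
  have rlU: "r_ann R (l_ann R U) = U"
    using rdual small_right_ideal_subset_jacobson_radical[OF U UJ] right_annihilatorD[OF _ U]
    by (simp add: right_small_dual_def)
  have "f ` T \<noteq> {\<zero>}" using simple by (simp add: simple_right_ideal_def)
  moreover have "\<zero> \<in> f ` T" using f_zero right_ideal_zero[OF T] by (metis image_eqI)
  ultimately obtain a where a: "a \<in> T" "f a \<noteq> \<zero>" by auto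
  have T_decomp: "\<exists>r\<in>carrier R. t \<ominus> a \<otimes> r \<in> U" if t: "t \<in> T" for t
  proof -
    have "right_multiples (f a) \<subseteq> f ` T"
      using simple a right_multiples_subset by (auto simp: simple_right_ideal_def)
    moreover have "right_multiples (f a) \<noteq> {\<zero>}"
      using right_multiples_self[OF f_in[OF a(1)]] a(2) by auto
    ultimately have "right_multiples (f a) = f ` T"
      using simple right_ideal_multiples[OF f_in[OF a(1)]] unfolding simple_right_ideal_def by blast
    then obtain r where r: "r \<in> carrier R" "f t = f a \<otimes> r"
      using t unfolding right_multiples_def by blast
    have "t \<ominus> a \<otimes> r = t \<oplus> a \<otimes> (\<ominus> r)"
      using r(1) Tc t a by (simp add: minus_eq r_minus)
    then have "f (t \<ominus> a \<otimes> r) = f a \<otimes> r \<oplus> f a \<otimes> (\<ominus> r)"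
      using r a t T by (simp add: f_add f_mult right_ideal_mult)
    also have "\<dots> = \<zero>" using r(1) f_in[OF a(1)] by (simp add: r_minus r_neg)
    finally show ?thesis
      using r(1) a t T by (auto simp: U_def right_ideal_minus right_ideal_mult)
  qed
  have ac [simp]: "a \<in> carrier R" "f a \<in> carrier R" using a Tc f_in by auto
  have "a \<notin> r_ann R (l_ann R U)" using a rlU by (simp add: U_def)
  then obtain d where d: "d \<in> l_ann R U" "d \<otimes> a \<noteq> \<zero>" by (auto simp: r_ann_def)
  have dc [simp]: "d \<in> carrier R" using d by (simp add: l_ann_def)
  have dU: "d \<otimes> u = \<zero>" if "u \<in> U" for u using d(1) that by (simp add: l_ann_def)
  define u where "u = d \<otimes> a"
  have uc [simp]: "u \<in> carrier R" by (simp add: u_def)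
  \<comment> \<open>If \<open>f a \<otimes> r\<close> were nonzero it would generate the simple
    image, so \<open>f a = f a \<otimes> r \<otimes> s\<close> for some \<open>s\<close>. Then
    \<open>a - ars\<close> is in the kernel \<open>U\<close>, and applying \<open>d\<close> gives
    \<open>u = urs = 0\<close>, against the choice of \<open>d\<close>.\<close>
  have ann: "f a \<otimes> r = \<zero>" if r: "r \<in> carrier R" "u \<otimes> r = \<zero>" for r
  proof (rule ccontr)
    assume nz: "f a \<otimes> r \<noteq> \<zero>"
    have "right_multiples (f a \<otimes> r) \<subseteq> f ` T"
      using simple a r f_mult[OF a(1) r(1), symmetric] right_multiples_subset
        right_ideal_mult[OF T a(1) r(1)]
      by (auto simp: simple_right_ideal_def)
    moreover have "right_multiples (f a \<otimes> r) \<noteq> {\<zero>}"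
      using right_multiples_self[of "f a \<otimes> r"] nz r by auto
    ultimately have "right_multiples (f a \<otimes> r) = f ` T"
      using simple right_ideal_multiples[of "f a \<otimes> r"] r(1) ac(2) m_closed
      unfolding simple_right_ideal_def by meson
    then have "f a \<in> right_multiples (f a \<otimes> r)" using a by blast
    then obtain s where s: "s \<in> carrier R" "f a = f a \<otimes> r \<otimes> s"
      unfolding right_multiples_def by blast
    have "a \<oplus> a \<otimes> (\<ominus> (r \<otimes> s)) \<in> T" using a T r s by (simp add: right_ideal_add right_ideal_mult)
    moreover have "f (a \<oplus> a \<otimes> (\<ominus> (r \<otimes> s))) = f a \<oplus> f a \<otimes> (\<ominus> (r \<otimes> s))"
      using a T r s by (simp add: f_add f_mult right_ideal_mult)
    moreover have "\<dots> = f a \<ominus> f a \<otimes> r \<otimes> s"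
      using r(1) s(1) by (simp add: minus_eq r_minus m_assoc)
    moreover have "\<dots> = \<zero>" using s(2)[symmetric] by (simp add: minus_eq r_neg)
    ultimately have "a \<oplus> a \<otimes> (\<ominus> (r \<otimes> s)) \<in> U" by (simp add: U_def)
    then have "d \<otimes> (a \<oplus> a \<otimes> (\<ominus> (r \<otimes> s))) = \<zero>" by (rule dU)
    then have "u \<ominus> u \<otimes> r \<otimes> s = \<zero>"
      using r(1) s(1) by (simp add: u_def minus_eq r_distr r_minus m_assoc)
    then show False using r s(1) d(2) by (simp add: u_def[symmetric] minus_eq)
  qed
  \<comment> \<open>The principal left ideal \<open>Ru\<close>, written as a principal right ideal
    of the opposite ring.\<close>
  let ?L = "ring.right_multiples (op_ring R) u"
  have L: "left_ideal ?L R"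
    using ring.right_ideal_multiples[OF ring_op_ring, of u] by simp
  have "a \<in> jacobson_radical R" using a TJ by auto
  then have "u \<in> jacobson_radical R"
    using left_ideal_jacobson_radical by (simp add: u_def left_ideal_def)
  then have "?L \<subseteq> jacobson_radical R"
    using ring.right_multiples_subset[OF ring_op_ring] left_ideal_jacobson_radical by simp
  then have "small_left_ideal ?L R"
    using ring.small_right_ideal_subset_jacobson_radical[OF ring_op_ring, of ?L] L by simp
  then have "l_ann R (r_ann R ?L) = ?L"
    using ldual ring.right_annihilatorD[OF ring_op_ring, of ?L] L by (simp add: left_small_dual_def)
  moreover have "f a \<in> l_ann R (r_ann R ?L)"
    using ann ring.right_multiples_self[OF ring_op_ring, of u]
    by (auto simp: l_ann_def r_ann_def)
  ultimately obtain e where e: "e \<in> carrier R" "f a = e \<otimes> u"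
    by (auto simp: ring.right_multiples_def[OF ring_op_ring])
  have "f t = (e \<otimes> d) \<otimes> t" if t: "t \<in> T" for t
  proof -
    obtain r where r: "r \<in> carrier R" "t \<ominus> a \<otimes> r \<in> U" using T_decomp[OF t] by auto
    have tc: "t \<in> carrier R" using Tc[OF t] .
    have t_eq: "t = (t \<ominus> a \<otimes> r) \<oplus> a \<otimes> r"
      using r(1) tc by (simp add: minus_eq a_assoc l_neg)
    have "f t = f a \<otimes> r"
      using r a T unfolding U_def
      by (subst t_eq) (simp add: f_add f_mult right_ideal_mult)
    also have "\<dots> = e \<otimes> (d \<otimes> (a \<otimes> r))" using e r(1) by (simp add: u_def m_assoc)
    also have "d \<otimes> (a \<otimes> r) = d \<otimes> t"
      using r(1) tc dU[OF r(2)] by (subst t_eq) (simp add: r_distr)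
    finally show ?thesis using e tc by (simp add: m_assoc)
  qed
  then show ?thesis using e by (auto intro!: bexI[of _ "e \<otimes> d"])
qed

text \<open>With \<open>I + K = R\<close>, extend the restriction of \<open>f\<close> to \<open>I \<inter> K\<close> as left multiplication
  by \<open>c\<close>, and glue \<open>f\<close> on \<open>I\<close> with \<open>c\<close> on \<open>K\<close>.\<close>

lemma right_simple_injective_if_small_dual:
  assumes wc: "weakly_complemented" and rdual: "right_small_dual R" and ldual: "left_small_dual R"
  shows "right_simple_injective R"
  unfolding right_simple_injective_def
proof (intro allI impI, elim conjE)
  fix I f assume I: "right_ideal I R" and f: "right_module_hom R I f"
    and simple: "simple_right_ideal (f ` I) R"
  have f_in: "\<And>x. x \<in> I \<Longrightarrow> f x \<in> carrier R"
    and f_add: "\<And>x y. x \<in> I \<Longrightarrow> y \<in> I \<Longrightarrow> f (x \<oplus> y) = f x \<oplus> f y"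
    and f_mult: "\<And>x r. x \<in> I \<Longrightarrow> r \<in> carrier R \<Longrightarrow> f (x \<otimes> r) = f x \<otimes> r"
    using f by (auto simp: right_module_hom_def)
  obtain K where K: "right_ideal K R" "I <+> K = carrier R" "I \<inter> K \<subseteq> jacobson_radical R"
    using wc I by (auto simp: weakly_complemented_def)
  let ?T = "I \<inter> K"
  have T: "right_ideal ?T R" using right_ideal_Int I K(1) .
  have fT: "right_module_hom R ?T f" using f by (auto simp: right_module_hom_def)
  have "right_ideal (f ` ?T) R"
  proof (rule right_idealI)
    show "f ` ?T \<subseteq> carrier R" using f_in by auto
    have "f \<zero> = \<zero>"
      using f_mult[OF right_ideal_zero[OF I], of \<zero>] f_in[OF right_ideal_zero[OF I]] by simp
    then show "\<zero> \<in> f ` ?T" using right_ideal_zero[OF T] by force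
    show "x \<oplus> y \<in> f ` ?T" if "x \<in> f ` ?T" "y \<in> f ` ?T" for x y
      using that f_add right_ideal_add[OF T] by (force simp del: Int_iff)
    show "x \<otimes> r \<in> f ` ?T" if "x \<in> f ` ?T" "r \<in> carrier R" for x r
      using that f_mult right_ideal_mult[OF T] by (force simp del: Int_iff)
  qed
  moreover have "f ` ?T \<subseteq> f ` I" by blast
  ultimately have cases: "f ` ?T = {\<zero>} \<or> f ` ?T = f ` I"
    using simple by (simp add: simple_right_ideal_def)
  \<comment> \<open>The image on \<open>I \<inter> K\<close> is a right ideal inside a simple one:
    either it vanishes and \<open>c = 0\<close> will do, or it is again simple.\<close>
  have "\<exists>c\<in>carrier R. \<forall>t\<in>?T. f t = c \<otimes> t"
  proof (cases "f ` ?T = {\<zero>}")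
    case True
    then show ?thesis
      using right_ideal_in_carrier[OF I] by (intro bexI[of _ \<zero>] ballI) (force, simp)
  next
    case False
    then have "simple_right_ideal (f ` ?T) R" using cases simple by simp
    then show ?thesis using simple_hom_from_radical_extends[OF rdual ldual T K(3) fT] by blast
  qed
  then obtain c where c: "c \<in> carrier R" "\<And>t. t \<in> ?T \<Longrightarrow> f t = c \<otimes> t" by auto
  obtain i k where ik: "i \<in> I" "k \<in> K" "\<one> = i \<oplus> k"
    using K(2) set_add_eq_carrier_iff[OF I K(1)] by auto
  have ikc [simp]: "i \<in> carrier R" "k \<in> carrier R"
    using ik I K(1) right_ideal_in_carrier by auto
  define b where "b = f i \<oplus> c \<otimes> k"
  have bc: "b \<in> carrier R" using f_in ik c by (simp add: b_def)
  have fb: "f x = b \<otimes> x" if x: "x \<in> I" for x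
  proof -
    have xc: "x \<in> carrier R" using right_ideal_in_carrier[OF I x] .
    have x_eq: "x = i \<otimes> x \<oplus> k \<otimes> x" using ik(3)[symmetric] xc by (simp add: l_distr[symmetric])
    have ix: "i \<otimes> x \<in> I" using right_ideal_mult[OF I ik(1) xc] .
    \<comment> \<open>This difference puts \<open>k \<otimes> x\<close> into \<open>I\<close> as
      well as \<open>K\<close>, where \<open>f\<close> is multiplication by
      \<open>c\<close>.\<close>
    have "k \<otimes> x = x \<ominus> i \<otimes> x"
      using xc by (subst (2) x_eq) (simp add: minus_eq a_comm[of _ "k \<otimes> x"] a_assoc r_neg)
    then have "k \<otimes> x \<in> I" using right_ideal_minus[OF I x ix] by simp
    then have kx: "k \<otimes> x \<in> ?T" using right_ideal_mult[OF K(1) ik(2) xc] by simp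
    have "f x = f (i \<otimes> x) \<oplus> f (k \<otimes> x)" using ix kx by (subst x_eq) (simp add: f_add)
    also have "\<dots> = b \<otimes> x"
      using c kx xc ik(1) f_in by (simp add: b_def f_mult l_distr m_assoc)
    finally show ?thesis .
  qed
  have "right_module_hom R (carrier R) (\<lambda>x. b \<otimes> x)"
    using bc by (simp add: right_module_hom_def r_distr m_assoc)
  then show "\<exists>g. right_module_hom R (carrier R) g \<and> (\<forall>x\<in>I. g x = f x)" using fb by auto
qed

end

context ring
begin

section \<open>Dual rings\<close>

text \<open>Annihilators turn maximal left ideals \<open>L\<close> with \<open>l(Q) \<subseteq> L\<close> and \<open>L \<inter> l(I) = 0\<close>, provided by
  Zorn's lemma, into minimal right ideals \<open>K = r(L)\<close> with \<open>K \<subseteq> Q\<close> and \<open>I + K = R\<close>.\<close>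

lemma dual_supplement:
  assumes rdual: "right_dual R" and ldual: "left_dual R"
    and I: "right_ideal I R" and Q: "right_ideal Q R" and IQ: "I <+> Q = carrier R"
  obtains K where "right_ideal K R" "K \<subseteq> Q" "I <+> K = carrier R"
    "\<And>K'. right_ideal K' R \<Longrightarrow> K' \<subseteq> K \<Longrightarrow> I <+> K' = carrier R \<Longrightarrow> K' = K"
proof -
  have rl: "r_ann R (l_ann R A) = A" if "right_ideal A R" for A
    using rdual right_annihilatorD that by (simp add: right_dual_def)
  have lr: "l_ann R (r_ann R A) = A" if "left_ideal A R" for A
    using ldual ring.right_annihilatorD[OF ring_op_ring, of A] that by (simp add: left_dual_def)
  have left: "left_ideal (l_ann R A) R" if "right_ideal A R" for A
    using left_ideal_l_ann right_ideal_subset that by blast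
  \<comment> \<open>\<open>l(Q) \<inter> l(I) = l(Q + I) = l(R) = 0\<close>. Zero has to be removed
    from the set to be avoided, as it lies in every left ideal.\<close>
  have "l_ann R Q \<inter> (l_ann R I - {\<zero>}) = {}"
    using l_ann_set_add[OF I Q] IQ l_ann_carrier by auto
  then obtain L where L: "left_ideal L R" "l_ann R Q \<subseteq> L" "L \<inter> (l_ann R I - {\<zero>}) = {}"
    and max: "\<And>L'. left_ideal L' R \<Longrightarrow> L \<subseteq> L' \<Longrightarrow> L' \<inter> (l_ann R I - {\<zero>}) = {} \<Longrightarrow> L' = L"
    using ring.right_ideal_Zorn[OF ring_op_ring, of "l_ann R Q" "l_ann R I - {\<zero>}"] left[OF Q]
    unfolding op_ring_ideals by metis
  have Lc: "L \<subseteq> carrier R" using ring.right_ideal_subset[OF ring_op_ring] L(1) by simp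
  define K where "K = r_ann R L"
  have K: "right_ideal K R" using right_ideal_r_ann Lc by (simp add: K_def)
  have lK: "l_ann R K = L" using lr L(1) by (simp add: K_def)
  have KQ: "K \<subseteq> Q" using r_ann_antimono[OF L(2)] rl[OF Q] by (simp add: K_def)
  have "\<zero> \<in> l_ann R I \<inter> L"
    using ring.right_ideal_zero[OF ring_op_ring] left[OF I] L(1) by simp
  then have "l_ann R (I <+> K) = {\<zero>}"
    using L(3) l_ann_set_add[OF I K] lK by auto
  then have IK: "I <+> K = carrier R"
    using rl[OF right_ideal_set_add[OF I K]] r_ann_zero by simp
  have "K' = K" if K': "right_ideal K' R" "K' \<subseteq> K" "I <+> K' = carrier R" for K'
  proof -
    have "l_ann R I \<inter> l_ann R K' = {\<zero>}"
      using l_ann_set_add[OF I K'(1)] K'(3) l_ann_carrier by simp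
    then have "l_ann R K' = L"
      using l_ann_antimono[OF K'(2)] lK by (intro max left K'(1)) auto
    then show ?thesis using rl[OF K'(1)] by (simp add: K_def)
  qed
  then show thesis using that[OF K KQ IK] by blast
qed

lemma weakly_complemented_if_dual:
  assumes "right_dual R" "left_dual R"
  shows "weakly_complemented"
  unfolding weakly_complemented_def
proof (intro allI impI)
  fix I assume I: "right_ideal I R"
  have "\<zero> \<oplus> \<one> = \<one>" by simp
  then have "I <+> carrier R = carrier R"
    using set_add_eq_carrier_iff[OF I right_ideal_carrier] right_ideal_zero[OF I] by force
  then obtain K where K: "right_ideal K R" "I <+> K = carrier R"
    "\<And>K'. right_ideal K' R \<Longrightarrow> K' \<subseteq> K \<Longrightarrow> I <+> K' = carrier R \<Longrightarrow> K' = K"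
    using dual_supplement[OF assms I right_ideal_carrier] by metis
  then show "\<exists>K. right_ideal K R \<and> I <+> K = carrier R \<and> I \<inter> K \<subseteq> jacobson_radical R"
    using minimal_complement_Int_subset_jacobson_radical[OF I] by blast
qed

text \<open>Writing \<open>1 = p + q\<close>, minimality of \<open>P\<close> gives \<open>pR = p\<^sup>2R\<close>, hence \<open>R = pR + r(p)\<close>. As
  \<open>r(p) \<subseteq> Q\<close>, minimality of \<open>Q\<close> gives \<open>r(p) = Q\<close>, so \<open>pq = 0\<close>.\<close>

lemma mutual_supplements_idempotent:
  assumes P: "right_ideal P R" and Q: "right_ideal Q R" and PQ: "P <+> Q = carrier R"
    and minP: "\<And>P'. right_ideal P' R \<Longrightarrow> P' \<subseteq> P \<Longrightarrow> P' <+> Q = carrier R \<Longrightarrow> P' = P"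
    and minQ: "\<And>Q'. right_ideal Q' R \<Longrightarrow> Q' \<subseteq> Q \<Longrightarrow> P <+> Q' = carrier R \<Longrightarrow> Q' = Q"
  obtains p where "p \<in> P" "\<one> \<ominus> p \<in> Q" "p \<otimes> p = p"
proof -
  obtain p q where pq: "p \<in> P" "q \<in> Q" "\<one> = p \<oplus> q"
    using PQ set_add_eq_carrier_iff[OF P Q] by auto
  have c [simp]: "p \<in> carrier R" "q \<in> carrier R"
    using pq P Q right_ideal_in_carrier by auto
  have split: "x = p \<otimes> x \<oplus> q \<otimes> x" if "x \<in> carrier R" for x
    using that pq(3)[symmetric] by (simp add: l_distr[symmetric])
  have split': "x = x \<otimes> p \<oplus> x \<otimes> q" if "x \<in> carrier R" for x
    using that pq(3)[symmetric] by (simp add: r_distr[symmetric])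
  have pp_qp: "p = p \<otimes> p \<oplus> q \<otimes> p" using split[of p] by simp
  \<comment> \<open>Expanding \<open>p\<close> once more shows that \<open>p \<otimes> p\<close>
    already generates a complement of \<open>Q\<close> inside \<open>P\<close>.\<close>
  have "\<one> = p \<otimes> p \<oplus> (q \<otimes> p \<oplus> q)"
    using pq(3) pp_qp by (simp add: a_assoc[symmetric])
  moreover have "q \<otimes> p \<oplus> q \<in> Q" using Q pq by (simp add: right_ideal_add right_ideal_mult)
  ultimately have "right_multiples (p \<otimes> p) <+> Q = carrier R"
    using set_add_eq_carrier_iff[OF right_ideal_multiples Q, of "p \<otimes> p"]
      right_multiples_self[of "p \<otimes> p"] by auto
  then have "right_multiples (p \<otimes> p) = P"
    using minP[OF right_ideal_multiples] right_multiples_subset[OF P] right_ideal_mult[OF P] pq(1)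
    by simp
  then obtain t where t: "t \<in> carrier R" "p = p \<otimes> p \<otimes> t"
    using pq(1) unfolding right_multiples_def by blast
  let ?r = "r_ann R {p}"
  have r: "right_ideal ?r R" by (simp add: right_ideal_r_ann)
  have "?r \<subseteq> Q"
  proof
    fix x assume "x \<in> ?r"
    then have x: "x \<in> carrier R" "p \<otimes> x = \<zero>" by (auto simp: r_ann_def)
    then have "x = q \<otimes> x" using split[of x] by simp
    then show "x \<in> Q" using right_ideal_mult[OF Q pq(2) x(1)] by simp
  qed
  moreover have "P <+> ?r = carrier R"
  proof -
    have "p \<otimes> (\<one> \<ominus> p \<otimes> t) = p \<ominus> p \<otimes> p \<otimes> t"
      using t(1) by (simp add: minus_eq r_distr r_minus m_assoc)
    also have "\<dots> = \<zero>" using t(2)[symmetric] by (simp add: minus_eq r_neg)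
    finally have "\<one> \<ominus> p \<otimes> t \<in> ?r" using t(1) by (simp add: r_ann_def)
    moreover have "\<one> = p \<otimes> t \<oplus> (\<one> \<ominus> p \<otimes> t)"
      using t(1) by (simp add: minus_eq a_lcomm[of "p \<otimes> t"] r_neg)
    ultimately show ?thesis
      using set_add_eq_carrier_iff[OF P r] right_ideal_mult[OF P pq(1) t(1)] by blast
  qed
  ultimately have "?r = Q" using minQ[OF r] by simp
  then have "p \<otimes> q = \<zero>" using pq(2) by (auto simp: r_ann_def)
  then have "p \<otimes> p = p" using split'[of p] by simp
  moreover have "\<one> \<ominus> p = q" unfolding pq(3) by (simp add: minus_eq a_comm[of p q] a_assoc r_neg)
  ultimately show thesis using that pq by simp
qed

section \<open>Lifting idempotents\<close>

lemma set_add_commute: "A \<subseteq> carrier R \<Longrightarrow> B \<subseteq> carrier R \<Longrightarrow> set_add R A B = set_add R B A"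
  unfolding set_eq_iff mem_set_add_iff by (metis a_comm subsetD)

lemma set_add_mono: "A \<subseteq> A' \<Longrightarrow> B \<subseteq> B' \<Longrightarrow> set_add R A B \<subseteq> set_add R A' B'"
  unfolding subset_iff mem_set_add_iff by blast

text \<open>The comaximal right ideals \<open>xR + J\<close> and \<open>(1 - x)R + J\<close> are
  shrunk one after the other to mutually minimal complements \<open>P\<close> and \<open>Q\<close>,
  which yield an idempotent \<open>p\<close>. From \<open>p \<in> xR + J\<close> and
  \<open>1 - p \<in> (1 - x)R + J\<close> it follows that \<open>(1 - x)p\<close> and
  \<open>x(1 - p)\<close> are in \<open>J\<close>; their difference is \<open>p - x\<close>.\<close>

lemma idempotents_lift_if_dual:
  assumes dual: "right_dual R" "left_dual R"
  shows "idempotents_lift_mod (jacobson_radical R) R"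
  unfolding idempotents_lift_mod_def
proof (intro ballI impI)
  let ?J = "jacobson_radical R"
  note J = right_ideal_jacobson_radical
  have J_left: "r \<otimes> j \<in> ?J" if "r \<in> carrier R" "j \<in> ?J" for r j
    using left_ideal_jacobson_radical that by (simp add: left_ideal_def)
  fix x assume x [simp]: "x \<in> carrier R" and xJ: "x \<otimes> x \<ominus> x \<in> ?J"
  have xJ': "x \<ominus> x \<otimes> x \<in> ?J"
  proof -
    have "\<zero> \<ominus> (x \<otimes> x \<ominus> x) \<in> ?J" using right_ideal_minus[OF J right_ideal_zero[OF J] xJ] .
    moreover have "\<zero> \<ominus> (x \<otimes> x \<ominus> x) = x \<ominus> x \<otimes> x"
      by (simp add: minus_eq minus_add a_comm)
    ultimately show ?thesis by simp
  qed
  let ?P0 = "right_multiples x <+> ?J" and ?Q0 = "right_multiples (\<one> \<ominus> x) <+> ?J"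
  have P0: "right_ideal ?P0 R" and Q0: "right_ideal ?Q0 R"
    using right_ideal_set_add[OF right_ideal_multiples J] by auto
  have "x \<in> ?P0" "\<one> \<ominus> x \<in> ?Q0"
    using set_add_upper_left[OF right_ideal_multiples J, of x] right_multiples_self[of x]
      set_add_upper_left[OF right_ideal_multiples J, of "\<one> \<ominus> x"]
      right_multiples_self[of "\<one> \<ominus> x"] by auto
  moreover have "\<one> = x \<oplus> (\<one> \<ominus> x)" by (simp add: minus_eq a_lcomm[of x] r_neg)
  ultimately have "?P0 <+> ?Q0 = carrier R" using set_add_eq_carrier_iff[OF P0 Q0] by blast
  then obtain Q where Q: "right_ideal Q R" "Q \<subseteq> ?Q0" "?P0 <+> Q = carrier R"
    and minQ: "\<And>Q'. right_ideal Q' R \<Longrightarrow> Q' \<subseteq> Q \<Longrightarrow> ?P0 <+> Q' = carrier R \<Longrightarrow> Q' = Q"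
    using dual_supplement[OF dual P0 Q0] by metis
  have comm: "A <+> Q = Q <+> A" if "right_ideal A R" for A
    using set_add_commute right_ideal_subset that Q(1) by blast
  have "Q <+> ?P0 = carrier R" using Q(3) comm[OF P0] by simp
  then obtain P where P: "right_ideal P R" "P \<subseteq> ?P0" "Q <+> P = carrier R"
    and minP: "\<And>P'. right_ideal P' R \<Longrightarrow> P' \<subseteq> P \<Longrightarrow> Q <+> P' = carrier R \<Longrightarrow> P' = P"
    using dual_supplement[OF dual Q(1) P0] by metis
  \<comment> \<open>\<open>Q\<close> was chosen minimal against the larger \<open>?P0\<close>. It
    stays minimal against \<open>P\<close>, because a complement of \<open>P\<close> is also one of
    \<open>?P0\<close>.\<close>
  have minQ': "Q' = Q" if Q': "right_ideal Q' R" "Q' \<subseteq> Q" "P <+> Q' = carrier R" for Q'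
  proof (rule minQ[OF Q'(1,2)])
    show "?P0 <+> Q' = carrier R"
      using set_add_mono[OF P(2) subset_refl, of Q'] Q'(3)
        right_ideal_subset[OF right_ideal_set_add[OF P0 Q'(1)]] by auto
  qed
  have minP': "P' = P" if "right_ideal P' R" "P' \<subseteq> P" "P' <+> Q = carrier R" for P'
    using minP that comm by simp
  have PQ: "P <+> Q = carrier R" using P(3) comm[OF P(1)] by simp
  obtain p where p: "p \<in> P" "\<one> \<ominus> p \<in> Q" "p \<otimes> p = p"
    by (rule mutual_supplements_idempotent[OF P(1) Q(1) PQ minP' minQ'])
  have pc [simp]: "p \<in> carrier R" using p P(1) right_ideal_in_carrier by auto
  obtain y j where y: "y \<in> carrier R" "j \<in> ?J" "p = x \<otimes> y \<oplus> j"
    using p(1) P(2) unfolding subset_iff mem_set_add_iff right_multiples_def by blast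
  obtain z j' where z: "z \<in> carrier R" "j' \<in> ?J" "\<one> \<ominus> p = (\<one> \<ominus> x) \<otimes> z \<oplus> j'"
    using p(2) Q(2) unfolding subset_iff mem_set_add_iff right_multiples_def by blast
  have jc: "j \<in> carrier R" "j' \<in> carrier R" using y(2) z(2) jacobson_radical_subset by auto
  \<comment> \<open>Modulo \<open>J\<close> the factor \<open>\<one> \<ominus> x\<close> kills
    \<open>x \<otimes> y\<close>, since \<open>x \<ominus> x \<otimes> x\<close> is in
    \<open>J\<close>.\<close>
  have "(\<one> \<ominus> x) \<otimes> p = (x \<ominus> x \<otimes> x) \<otimes> y \<oplus> (\<one> \<ominus> x) \<otimes> j"
    unfolding y(3) using y(1) jc(1) x by algebra
  then have 1: "(\<one> \<ominus> x) \<otimes> p \<in> ?J"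
    using y J_left right_ideal_mult[OF J xJ'] right_ideal_add[OF J] by simp
  have "x \<otimes> (\<one> \<ominus> p) = (x \<ominus> x \<otimes> x) \<otimes> z \<oplus> x \<otimes> j'"
    unfolding z(3) using z(1) jc(2) x by algebra
  then have 2: "x \<otimes> (\<one> \<ominus> p) \<in> ?J"
    using z J_left right_ideal_mult[OF J xJ'] right_ideal_add[OF J] by simp
  have "x \<otimes> \<one> = x" by simp
  then have "(\<one> \<ominus> x) \<otimes> p \<ominus> x \<otimes> (\<one> \<ominus> p) = p \<ominus> x"
    using x pc by algebra
  then have "p \<ominus> x \<in> ?J" using right_ideal_minus[OF J 1 2] by simp
  then show "\<exists>e\<in>carrier R. e \<otimes> e = e \<and> e \<ominus> x \<in> ?J" using p(3) pc by blast
qed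

section \<open>The quotient by the radical\<close>

text \<open>Take \<open>e\<close> to be the component of \<open>\<one>\<close> in \<open>I\<close>.
  For \<open>x\<close> in \<open>I\<close> the other component
  \<open>k \<otimes> x = x \<ominus> e \<otimes> x\<close> lies in \<open>I \<inter> K\<close>,
  hence is zero.\<close>

lemma semisimple_right_ideal_idempotent:
  assumes "semisimple_ring R" and I: "right_ideal I R"
  obtains e where "e \<in> I" "\<And>x. x \<in> I \<Longrightarrow> e \<otimes> x = x"
proof -
  obtain K where K: "right_ideal K R" "I <+> K = carrier R" "I \<inter> K = {\<zero>}"
    using assms unfolding semisimple_ring_def by blast
  obtain e k where ek: "e \<in> I" "k \<in> K" "\<one> = e \<oplus> k"
    using K(2) set_add_eq_carrier_iff[OF I K(1)] by auto
  have c [simp]: "e \<in> carrier R" "k \<in> carrier R"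
    using ek I K right_ideal_in_carrier by auto
  have "e \<otimes> x = x" if x: "x \<in> I" for x
  proof -
    have xc [simp]: "x \<in> carrier R" using right_ideal_in_carrier[OF I x] .
    have x_eq: "x = e \<otimes> x \<oplus> k \<otimes> x" using ek(3)[symmetric] by (simp add: l_distr[symmetric])
    have "k \<otimes> x = x \<ominus> e \<otimes> x"
      by (subst (2) x_eq) (simp add: minus_eq a_comm[of _ "k \<otimes> x"] a_assoc r_neg)
    then have "k \<otimes> x \<in> I" using right_ideal_minus[OF I x] right_ideal_mult[OF I ek(1)] by simp
    then have "k \<otimes> x = \<zero>" using K(3) right_ideal_mult[OF K(1) ek(2)] by auto
    then show ?thesis using x_eq by simp
  qed
  then show thesis using that ek(1) by blast
qed

text \<open>The left annihilators of a descending chain of right ideals ascend to a union which is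
  generated by an idempotent, so they stabilise.\<close>

lemma right_artinian_if_semisimple:
  assumes ss: "semisimple_ring R" and ss_op: "semisimple_ring (op_ring R)"
  shows "right_artinian R"
  unfolding right_artinian_def
proof (intro allI impI)
  fix I :: "nat \<Rightarrow> 'a set" assume I: "\<forall>n. right_ideal (I n) R \<and> I (Suc n) \<subseteq> I n"
  \<comment> \<open>Needed to return from the left annihilators to the chain:
    \<open>\<one> \<ominus> e\<close> annihilates \<open>I n\<close>, and an element killed by it
    equals its product with \<open>e\<close>, so it is in \<open>I n\<close>.\<close>
  have rl: "r_ann R (l_ann R (I n)) = I n" for n
  proof -
    have In: "right_ideal (I n) R" using I by simp
    obtain e where e: "e \<in> I n" "\<And>x. x \<in> I n \<Longrightarrow> e \<otimes> x = x"
      using semisimple_right_ideal_idempotent[OF ss In] by metis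
    have ec [simp]: "e \<in> carrier R" using right_ideal_in_carrier[OF In e(1)] .
    have "y \<in> I n" if y: "y \<in> r_ann R (l_ann R (I n))" for y
    proof -
      have yc [simp]: "y \<in> carrier R" using y by (simp add: r_ann_def)
      have "\<one> \<ominus> e \<in> l_ann R (I n)"
        using e(2) right_ideal_in_carrier[OF In]
        by (auto simp: l_ann_def minus_eq l_distr l_minus r_neg)
      then have "(\<one> \<ominus> e) \<otimes> y = \<zero>" using y by (simp add: r_ann_def)
      moreover have "y = (\<one> \<ominus> e) \<otimes> y \<oplus> e \<otimes> y"
        by (simp add: minus_eq l_distr l_minus a_assoc l_neg)
      ultimately have "y = e \<otimes> y" by simp
      then show ?thesis using right_ideal_mult[OF In e(1) yc] by simp
    qed
    then show ?thesis using subset_r_ann_l_ann[OF right_ideal_subset[OF In]] by auto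
  qed
  have left: "left_ideal (l_ann R (I n)) R" for n
    using I left_ideal_l_ann right_ideal_subset by blast
  have "I n \<subseteq> I m" if "m \<le> n" for m n
    using lift_Suc_antimono_le[of I] I that by blast
  then have mono: "l_ann R (I m) \<subseteq> l_ann R (I n)" if "m \<le> n" for m n
    using l_ann_antimono that by blast
  have "left_ideal (\<Union>n. l_ann R (I n)) R"
  proof -
    have "right_ideal (\<Union>n. l_ann R (I n)) (op_ring R)"
    proof (rule ring.right_ideal_Union_chain[OF ring_op_ring])
      fix X Y assume "X \<in> range (\<lambda>n. l_ann R (I n))" "Y \<in> range (\<lambda>n. l_ann R (I n))"
      then obtain m n where "X = l_ann R (I m)" "Y = l_ann R (I n)" by blast
      then show "X \<subseteq> Y \<or> Y \<subseteq> X" using mono nat_le_linear[of m n] by blast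
    qed (use left in auto)
    then show ?thesis by simp
  qed
  then obtain e where e: "e \<in> (\<Union>n. l_ann R (I n))" "\<And>x. x \<in> (\<Union>n. l_ann R (I n)) \<Longrightarrow> x \<otimes> e = x"
    using ring.semisimple_right_ideal_idempotent[OF ring_op_ring ss_op]
    unfolding op_ring_simps op_ring_ideals by metis
  \<comment> \<open>Some stage contains \<open>e\<close>; as \<open>x = x \<otimes> e\<close>
    throughout the union, this stage absorbs all later ones.\<close>
  then obtain N where N: "e \<in> l_ann R (I N)" by auto
  have "I n = I N" if "n \<ge> N" for n
  proof -
    have "l_ann R (I n) \<subseteq> l_ann R (I N)"
    proof
      fix x assume x: "x \<in> l_ann R (I n)"
      then have "x \<otimes> e \<in> l_ann R (I N)"
        using N left[of N] l_ann_subset unfolding left_ideal_def by blast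
      moreover have "x \<otimes> e = x" using e(2) x by blast
      ultimately show "x \<in> l_ann R (I N)" by simp
    qed
    then have "l_ann R (I n) = l_ann R (I N)" using mono[OF that] by auto
    then show ?thesis using rl by metis
  qed
  then show "\<exists>N. \<forall>n\<ge>N. I n = I N" by blast
qed

section \<open>Passing between right ideals of \<open>R\<close> and of \<open>R/J\<close>\<close>

lemma carrier_Quot: "carrier (R Quot J) = (+>) J ` carrier R"
  unfolding FactRing_def A_RCOSETS_def' by auto

lemma zero_Quot: "\<zero>\<^bsub>R Quot J\<^esub> = J"
  by (simp add: FactRing_def)

lemma right_ideal_quotient_image:
  assumes "ideal J R" and K: "right_ideal K R"
  shows "right_ideal ((+>) J ` K) (R Quot J)"
proof -
  interpret ideal J R by fact
  interpret h: ring_hom_ring R "R Quot J" "(+>) J" by (rule rcos_ring_hom_ring)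
  note Kc [simp] = right_ideal_in_carrier[OF K]
  show ?thesis
  proof (rule h.S.right_idealI)
    show "(+>) J ` K \<subseteq> carrier (R Quot J)" by auto
    show "\<zero>\<^bsub>R Quot J\<^esub> \<in> (+>) J ` K" using right_ideal_zero[OF K] h.hom_zero by (metis image_eqI)
  next
    fix x y assume "x \<in> (+>) J ` K" "y \<in> (+>) J ` K"
    then show "x \<oplus>\<^bsub>R Quot J\<^esub> y \<in> (+>) J ` K"
      using right_ideal_add[OF K] by (auto simp: h.hom_add[symmetric] simp del: h.hom_add)
  next
    fix x r assume x: "x \<in> (+>) J ` K" and r: "r \<in> carrier (R Quot J)"
    obtain s where "r = J +> s" "s \<in> carrier R"
      using r unfolding carrier_Quot by (rule imageE)
    then show "x \<otimes>\<^bsub>R Quot J\<^esub> r \<in> (+>) J ` K"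
      using x right_ideal_mult[OF K] by (auto simp: h.hom_mult[symmetric] simp del: h.hom_mult)
  qed
qed

text \<open>A weak supplement of the preimage of \<open>I\<close> maps onto a true complement of
  \<open>I\<close>, because the overlap lies in the radical and disappears in the quotient.\<close>

lemma semisimple_quotient_if_weakly_complemented:
  assumes wc: "weakly_complemented"
  shows "semisimple_ring (R Quot jacobson_radical R)"
  unfolding semisimple_ring_def
proof (intro allI impI)
  let ?J = "jacobson_radical R"
  let ?Q = "R Quot ?J"
  interpret ideal ?J R by (rule ideal_jacobson_radical)
  interpret h: ring_hom_ring R ?Q "(+>) ?J" by (rule rcos_ring_hom_ring)
  fix I assume I: "right_ideal I ?Q"
  define I' where "I' = {x \<in> carrier R. ?J +> x \<in> I}"
  have I': "right_ideal I' R"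
    using I by (intro right_idealI) (auto simp: I'_def h.S.right_ideal_zero h.S.right_ideal_add
        h.S.right_ideal_mult)
  then obtain K where K: "right_ideal K R" "I' <+> K = carrier R" "I' \<inter> K \<subseteq> ?J"
    using wc by (auto simp: weakly_complemented_def)
  let ?K = "(+>) ?J ` K"
  have hK: "right_ideal ?K ?Q"
    using right_ideal_quotient_image[OF ideal_jacobson_radical K(1)] .
  obtain i k where ik: "i \<in> I'" "k \<in> K" "\<one> = i \<oplus> k"
    using K(2) set_add_eq_carrier_iff[OF I' K(1)] by auto
  have "\<one>\<^bsub>?Q\<^esub> = (?J +> i) \<oplus>\<^bsub>?Q\<^esub> (?J +> k)"
    using ik I' K(1) right_ideal_in_carrier by (metis h.hom_add h.hom_one)
  then have "I <+>\<^bsub>?Q\<^esub> ?K = carrier ?Q"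
    using h.S.set_add_eq_carrier_iff[OF I hK] ik by (auto simp: I'_def)
  moreover have "I \<inter> ?K \<subseteq> {\<zero>\<^bsub>?Q\<^esub>}"
  proof
    fix z assume z: "z \<in> I \<inter> ?K"
    then obtain k where k: "k \<in> K" "z = ?J +> k" by auto
    then have "k \<in> I' \<inter> K" using z right_ideal_in_carrier[OF K(1)] by (auto simp: I'_def)
    then have "k \<in> ?J" using K(3) by auto
    then show "z \<in> {\<zero>\<^bsub>?Q\<^esub>}" unfolding k(2) zero_Quot using a_rcos_const by blast
  qed
  ultimately show "\<exists>K. right_ideal K ?Q \<and> I <+>\<^bsub>?Q\<^esub> K = carrier ?Q \<and> I \<inter> K = {\<zero>\<^bsub>?Q\<^esub>}"
    using hK h.S.right_ideal_zero[OF I] h.S.right_ideal_zero[OF hK] by blast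
qed

text \<open>A right ideal containing \<open>J\<close> is a union of cosets of \<open>J\<close>,
  hence determined by its image in the quotient.\<close>

lemma artinian_quotient_chain_stabilises:
  assumes J: "ideal J R" and art: "right_artinian (R Quot J)"
    and K: "\<And>n::nat. right_ideal (K n) R" "\<And>n. K (Suc n) \<subseteq> K n" "\<And>n. J \<subseteq> K n"
  shows "\<exists>N. \<forall>n\<ge>N. K n = K N"
proof -
  interpret ideal J R by (rule J)
  have "\<forall>n. right_ideal ((+>) J ` K n) (R Quot J) \<and> (+>) J ` K (Suc n) \<subseteq> (+>) J ` K n"
    using right_ideal_quotient_image[OF J K(1)] K(2) by blast
  then obtain N where N: "\<And>n. n \<ge> N \<Longrightarrow> (+>) J ` K n = (+>) J ` K N"
    using art[unfolded right_artinian_def, rule_format, of "\<lambda>n. (+>) J ` K n"] by auto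
  have sub: "K m \<subseteq> K n" if eq: "(+>) J ` K m = (+>) J ` K n" for m n
  proof
    fix x assume x: "x \<in> K m"
    then obtain y where y: "y \<in> K n" "J +> x = J +> y" using eq by blast
    have xy: "x \<in> carrier R" "y \<in> carrier R"
      using x y right_ideal_in_carrier[OF K(1)] by auto
    then have "x \<in> J +> y" using y(2) a_rcos_self by blast
    then obtain j where "j \<in> J" "x = j \<oplus> y" by (auto simp: a_r_coset_def')
    then show "x \<in> K n" using K(3) y(1) right_ideal_add[OF K(1)] by blast
  qed
  have "K n = K N" if "n \<ge> N" for n
    using sub[OF N[OF that]] sub[OF N[OF that, symmetric]] by blast
  then show ?thesis by blast
qed

text \<open>The chain condition gives a complement of \<open>I\<close> that is minimal among those
  containing \<open>J\<close>; without one, dependent choice would build a strictly descending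
  chain. Minimality of this restricted kind already forces the intersection with \<open>I\<close>
  into \<open>J\<close>.\<close>

lemma weakly_complemented_if_artinian_quotient:
  assumes art: "right_artinian (R Quot jacobson_radical R)"
  shows "weakly_complemented"
  unfolding weakly_complemented_def
proof (intro allI impI)
  let ?J = "jacobson_radical R"
  fix I assume I: "right_ideal I R"
  define P where "P K \<longleftrightarrow> right_ideal K R \<and> ?J \<subseteq> K \<and> I <+> K = carrier R" for K
  have "\<exists>K. P K \<and> (\<forall>K'. P K' \<and> K' \<subseteq> K \<longrightarrow> K' = K)"
  proof (rule ccontr)
    assume "\<not> ?thesis"
    then have step: "\<And>K. P K \<Longrightarrow> \<exists>K'. P K' \<and> K' \<subset> K" by blast
    have "I <+> carrier R = carrier R"
      using right_ideal_subset[OF right_ideal_set_add[OF I right_ideal_carrier]]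
        set_add_upper_right[OF I right_ideal_carrier] by auto
    then have "P (carrier R)"
      using jacobson_radical_subset right_ideal_carrier by (simp add: P_def)
    then obtain K where K: "\<And>n::nat. P (K n)" "\<And>n. K (Suc n) \<subset> K n"
      using dependent_nat_choice[of "\<lambda>_. P" "\<lambda>_ K K'. K' \<subset> K"] step by metis
    have "\<exists>N. \<forall>n\<ge>N. K n = K N"
      using K(1) psubset_imp_subset[OF K(2)]
      by (intro artinian_quotient_chain_stabilises[OF ideal_jacobson_radical art])
        (simp_all add: P_def)
    then obtain N where "K (Suc N) = K N" using le_SucI by blast
    then show False using K(2)[of N] by auto
  qed
  then obtain K where K: "P K" "\<And>K'. P K' \<Longrightarrow> K' \<subseteq> K \<Longrightarrow> K' = K" by blast
  then have "I \<inter> K \<subseteq> ?J"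
    unfolding P_def
    by (intro minimal_complement_Int_subset_jacobson_radical[OF I]) (auto simp: Int_absorb1)
  then show "\<exists>K. right_ideal K R \<and> I <+> K = carrier R \<and> I \<inter> K \<subseteq> ?J"
    using K(1) by (auto simp: P_def)
qed

lemma semilocal_weakly_complemented:
  assumes "semilocal R"
  shows "weakly_complemented" "ring.weakly_complemented (op_ring R)"
proof -
  have "right_artinian (R Quot jacobson_radical R)" "left_artinian (R Quot jacobson_radical R)"
    using assms by (auto simp: semilocal_def semisimple_artinian_def)
  then show "weakly_complemented" "ring.weakly_complemented (op_ring R)"
    using weakly_complemented_if_artinian_quotient
      ring.weakly_complemented_if_artinian_quotient[OF ring_op_ring]
    by (simp_all add: op_ring_Quot[symmetric])
qed

section \<open>The implications between the four conditions\<close>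

lemma semiperfect_if_dual:
  assumes "dual_ring R"
  shows "semiperfect R"
proof -
  have dual: "right_dual R" "left_dual R" using assms by (auto simp: dual_ring_def)
  let ?Q = "R Quot jacobson_radical R"
  have Q: "ring ?Q" using ideal.quotient_is_ring[OF ideal_jacobson_radical] .
  have ss: "semisimple_ring ?Q"
    using semisimple_quotient_if_weakly_complemented weakly_complemented_if_dual dual by blast
  \<comment> \<open>\<open>semisimple_ring\<close> speaks of right ideals only, so the left-sided
    statement is made over the opposite ring. Both are needed for either chain condition.\<close>
  have ss_op: "semisimple_ring (op_ring ?Q)"
    using ring.semisimple_quotient_if_weakly_complemented[OF ring_op_ring]
      ring.weakly_complemented_if_dual[OF ring_op_ring] dual
    by (simp add: op_ring_Quot)
  have "right_artinian ?Q" using ring.right_artinian_if_semisimple[OF Q ss ss_op] .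
  moreover have "left_artinian ?Q"
    using ring.right_artinian_if_semisimple[OF ring.ring_op_ring[OF Q] ss_op] ss by simp
  ultimately show ?thesis
    using ss idempotents_lift_if_dual[OF dual]
    by (simp add: semiperfect_def semilocal_def semisimple_artinian_def)
qed

lemma kasch_simple_injective_if_semilocal_small_dual:
  assumes "semilocal R" "small_dual_ring R"
  shows "two_sided_kasch R \<and> two_sided_simple_injective R"
proof -
  note wc = semilocal_weakly_complemented[OF assms(1)]
  have sd: "right_small_dual R" "left_small_dual R" using assms(2) by (auto simp: small_dual_ring_def)
  have "right_kasch R" "right_simple_injective R"
    using right_kasch_if_small_dual right_simple_injective_if_small_dual wc(1) sd by auto
  moreover have "left_kasch R" "left_simple_injective R"
    using ring.right_kasch_if_small_dual[OF ring_op_ring wc(2)]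
      ring.right_simple_injective_if_small_dual[OF ring_op_ring wc(2)] sd by auto
  ultimately show ?thesis by (simp add: two_sided_kasch_def two_sided_simple_injective_def)
qed

lemma dual_if_kasch_simple_injective:
  assumes "two_sided_kasch R" "two_sided_simple_injective R"
  shows "dual_ring R"
  using assms right_dual_if_kasch_simple_injective
    ring.right_dual_if_kasch_simple_injective[OF ring_op_ring]
  by (simp add: two_sided_kasch_def two_sided_simple_injective_def dual_ring_def)

end

lemma small_dual_if_dual: "dual_ring R \<Longrightarrow> small_dual_ring R"
  by (simp add: dual_ring_def small_dual_ring_def right_dual_def left_dual_def
      right_small_dual_def left_small_dual_def small_right_ideal_def small_left_ideal_def)

theorem theorem3p1:
  fixes R :: "('a, 'b) ring_scheme"
  assumes "ring R"
  shows "(dual_ring R \<longleftrightarrow> semilocal R \<and> small_dual_ring R) \<and>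
         (dual_ring R \<longleftrightarrow> semiperfect R \<and> small_dual_ring R) \<and>
         (dual_ring R \<longleftrightarrow> two_sided_kasch R \<and> two_sided_simple_injective R)"
proof -
  interpret ring R by fact
  \<comment> \<open>The trivial link of the cycle (1), (3), (2), (4), (1) of implications.\<close>
  have "semiperfect R \<Longrightarrow> semilocal R" by (simp add: semiperfect_def)
  then show ?thesis
    using semiperfect_if_dual small_dual_if_dual kasch_simple_injective_if_semilocal_small_dual
      dual_if_kasch_simple_injective by blast
qed

end
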